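(* For an integer $T\ge 1$ let $$\mathcal F(T)=\{a/b:\ (a,b)\in\mathbb Z^2,\ 0\le a<b\le T,\ \gcd(a,b)=1\}$$ be the set of Farey fractions of order $T$, let $F(T)=\#\mathcal F(T)$, let $$G(T)=\sum_{\substack{\xi\in\mathcal F(T)\\ \xi\le 1/2}}\xi^2,$$ and let $$C(T)=\sum_{a/b\in\mathcal F(T)\cap[0,1/2]}\#\bigl(\mathcal F(T)\cap[1-a^2/b^2,\,1]\bigr),$$ where each $a/b$ is written in lowest terms. Let $M(t)=\sum_{1\le k\le t}\mu(k)$, where $\mu$ is the M\"obius function, and let $\delta(t)$ be any decreasing function such that $|M(t)|\le t\,\delta(t)$ holds for all $t\ge 1$. Then, as $T\to\infty$, $$C(T)=F(T)G(T)+O\bigl(T^{11/4+o(1)}+T^3\,\delta(T^{1/2})\log T\bigr),$$ where the implied constant is absolute.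
   Context: $\mu$ denotes the M\"obius function. The notation $A=O(B)$ means $|A|\le c|B|$ for an absolute constant $c>0$, and $o(1)$ denotes a quantity tending to $0$ as $T\to\infty$. *)

theory Defs
  imports "HOL-Analysis.Analysis" "HOL-Computational_Algebra.Squarefree"
begin

definition moebius_mu :: "nat \<Rightarrow> int" where
  "moebius_mu n = (if n = 0 \<or> \<not> squarefree n then 0 else (-1) ^ card (prime_factors n))"

definition mertens :: "real \<Rightarrow> real" where
  "mertens t = (\<Sum>k\<in>{1..nat \<lfloor>t\<rfloor>}. real_of_int (moebius_mu k))"

definition farey :: "nat \<Rightarrow> real set" where
  "farey T = {real_of_int a / real_of_int b | a b.
      0 \<le> a \<and> a < b \<and> b \<le> int T \<and> coprime a b}"

definition farey_count :: "nat \<Rightarrow> real" where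
  "farey_count T = real (card (farey T))"

definition farey_G :: "nat \<Rightarrow> real" where
  "farey_G T = (\<Sum>\<xi>\<in>{\<xi>\<in>farey T. \<xi> \<le> 1/2}. \<xi>^2)"

definition farey_C :: "nat \<Rightarrow> real" where
  "farey_C T = (\<Sum>\<xi>\<in>farey T \<inter> {0..1/2}. real (card (farey T \<inter> {1 - \<xi>^2..1})))"

end

theory Submission
  imports Defs "HOL-Real_Asymp.Real_Asymp"
begin

text \<open>
  Reflecting \<open>\<xi> \<mapsto> 1 - \<xi>\<close> and detecting coprimality with the Moebius function, the number of Farey
  fractions in \<open>[1 - x, 1]\<close> is \<open>\<Sum>\<^sub>m \<lfloor>x m\<rfloor> M(T/m)\<close>; for \<open>x = 1\<close> this is \<open>F(T)\<close>. Hence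
  \<open>C(T) - F(T) G(T) = - \<Sum>\<^sub>m M(T/m) \<Sum>\<^sub>\<xi> frac (m \<xi>\<^sup>2)\<close>. For \<open>m \<le> \<surd>T\<close> the trivial bound on the
  inner sum gives the \<open>\<delta>\<close>-term. For \<open>m > \<surd>T\<close> write \<open>frac = 1/2 + (frac - 1/2)\<close>: the constant part
  is handled by \<open>\<Sum>\<^sub>m M(T/m) = 1\<close>, while the sawtooth is replaced by its Fejer means, so that one
  needs the sums \<open>E(hm)\<close> with \<open>E(n) = \<Sum>\<^sub>\<xi> e(n \<xi>\<^sup>2)\<close> on average over \<open>m\<close>. By positivity the second
  moment of \<open>E(hm)\<close> over \<open>m\<close> is at most that of \<open>E(n)\<close> over all \<open>n\<close>, which opens to
  \<open>\<Sum>\<^sub>\<xi> \<Sum>\<^sub>\<eta> 1/\<bar>\<xi>\<^sup>2 - \<eta>\<^sup>2\<bar>\<close> plus a diagonal term and is controlled by the \<open>1/T\<^sup>2\<close>-spacing of Farey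
  fractions. The logarithms lost are absorbed by \<open>\<epsilon>(T) = 3 ln ln T / ln T\<close>.
\<close>

section \<open>Moebius inversion and counting Farey fractions\<close>

lemma moebius_mu_prime_mult:
  assumes "prime p" "squarefree d" "\<not> p dvd d"
  shows "squarefree (p * d)" "moebius_mu (p * d) = - moebius_mu d"
proof -
  have d: "d \<noteq> 0" using assms(3) by (auto intro: ccontr)
  have p: "p \<noteq> 0" "squarefree p" using assms(1) by (auto intro: squarefree_prime)
  show sf: "squarefree (p * d)"
    using assms p prime_imp_coprime by (intro squarefree_mult_coprime) auto
  have "prime_factors (p * d) = insert p (prime_factors d)"
    using d p assms(1) by (simp add: prime_factors_product prime_prime_factors)
  moreover have "p \<notin> prime_factors d"
    using assms(3) by auto
  ultimately have "card (prime_factors (p * d)) = Suc (card (prime_factors d))"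
    by simp
  thus "moebius_mu (p * d) = - moebius_mu d"
    using sf d p assms(2) by (simp add: moebius_mu_def)
qed

text \<open>For a prime \<open>p\<close> dividing \<open>n\<close>, the map
  \<open>d \<mapsto> p * d\<close> pairs the squarefree divisors prime to \<open>p\<close> with the
  squarefree divisors divisible by \<open>p\<close>. It flips the sign of \<open>moebius_mu\<close>,
  so the two halves cancel.\<close>

lemma sum_divisors_moebius_mu:
  assumes "n > 0"
  shows "(\<Sum>d | d dvd n. moebius_mu d) = (if n = 1 then 1 else 0)"
proof (cases "n = 1")
  case True
  thus ?thesis by (simp add: moebius_mu_def)
next
  case False
  then obtain p where p: "prime p" "p dvd n"
    using prime_factor_nat by blast
  have fin: "finite {d. d dvd n}" using assms by simp
  define A where "A = {d. d dvd n \<and> squarefree d \<and> \<not> p dvd d}"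
  define B where "B = {d. d dvd n \<and> squarefree d \<and> p dvd d}"
  have finAB: "finite A" "finite B"
    unfolding A_def B_def by (auto intro: finite_subset[OF _ fin])
  have "(\<Sum>d | d dvd n. moebius_mu d) = (\<Sum>d\<in>A \<union> B. moebius_mu d)"
    using fin by (intro sum.mono_neutral_right) (auto simp: A_def B_def moebius_mu_def)
  also have "\<dots> = (\<Sum>d\<in>A. moebius_mu d) + (\<Sum>d\<in>B. moebius_mu d)"
    using finAB by (intro sum.union_disjoint) (auto simp: A_def B_def)
  also have "(\<Sum>d\<in>B. moebius_mu d) = (\<Sum>d\<in>A. moebius_mu (p * d))"
  proof (rule sum.reindex_bij_witness[of _ "\<lambda>d. p * d" "\<lambda>d. d div p"])
    fix d assume "d \<in> B"
    then obtain k where k: "d = p * k" "p * k dvd n" "squarefree (p * k)" by (auto simp: B_def)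
    have "\<not> p dvd k"
    proof
      assume "p dvd k"
      hence "p\<^sup>2 dvd p * k" by (simp add: power2_eq_square)
      with k(3) p(1) show False by (auto simp: squarefree_def)
    qed
    moreover have "k dvd n" using k(2) by (rule dvd_mult_right)
    moreover have "squarefree k" using k(3) by (rule squarefree_multD)
    ultimately show "d div p \<in> A" using k(1) p(1) by (simp add: A_def prime_gt_0_nat)
  next
    fix d assume d: "d \<in> A"
    hence "coprime p d" using p(1) by (auto simp: A_def prime_imp_coprime)
    thus "p * d \<in> B"
      using d p moebius_mu_prime_mult(1) by (auto simp: A_def B_def divides_mult)
  qed (use p(1) in \<open>auto simp: A_def B_def prime_gt_0_nat\<close>)
  also have "\<dots> = - (\<Sum>d\<in>A. moebius_mu d)"
    unfolding sum_negf[symmetric]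
    by (intro sum.cong) (use p(1) moebius_mu_prime_mult(2) in \<open>auto simp: A_def\<close>)
  finally show ?thesis using False by simp
qed

text \<open>Write \<open>n = m * k\<close> with \<open>k\<close> the divisor carrying
  \<open>moebius_mu\<close>. For fixed \<open>m\<close> the cofactor \<open>k\<close> runs up to
  \<open>T div m\<close>, the floor of \<open>T / m\<close>, so its sum is a Mertens value.\<close>

lemma sum_moebius_mu_convolution:
  fixes f :: "nat \<Rightarrow> real"
  shows "(\<Sum>n=1..T. \<Sum>d | d dvd n. moebius_mu d * f (n div d)) =
         (\<Sum>m=1..T. f m * mertens (real T / real m))"
proof -
  have "(\<Sum>n=1..T. \<Sum>d | d dvd n. moebius_mu d * f (n div d)) =
        (\<Sum>(n, d)\<in>(SIGMA n:{1..T}. {d. d dvd n}). moebius_mu d * f (n div d))"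
    by (intro sum.Sigma) auto
  also have "\<dots> = (\<Sum>(m, k)\<in>(SIGMA m:{1..T}. {1..T div m}). f m * moebius_mu k)"
  proof (rule sum.reindex_bij_witness[of _ "\<lambda>(m, k). (m * k, k)" "\<lambda>(n, d). (n div d, d)"])
    fix x assume "x \<in> (SIGMA n:{1..T}. {d. d dvd n})"
    then obtain d k where x: "x = (d * k, d)" "0 < d" "0 < k" "d * k \<le> T"
      by (auto elim!: dvdE simp: Suc_le_eq)
    have "k \<le> d * k" using x by simp
    hence "k \<le> T" using x(4) by (rule order_trans)
    thus "(case x of (n, d) \<Rightarrow> (n div d, d)) \<in> (SIGMA m:{1..T}. {1..T div m})"
      using x by (auto simp: less_eq_div_iff_mult_less_eq)
  qed (auto simp: less_eq_div_iff_mult_less_eq Suc_le_eq mult.commute elim!: dvdE)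
  also have "\<dots> = (\<Sum>m=1..T. \<Sum>k\<in>{1..T div m}. f m * moebius_mu k)"
    by (intro sum.Sigma[symmetric]) auto
  also have "\<dots> = (\<Sum>m=1..T. f m * mertens (real T / real m))"
    by (intro sum.cong refl)
      (simp add: mertens_def floor_divide_of_nat_eq sum_distrib_left flip: of_nat_div)
  finally show ?thesis .
qed

text \<open>The convolution identity with \<open>f = 1\<close> leaves only the term
  \<open>n = 1\<close>. This later trades a sum over large \<open>m\<close> for one over small
  \<open>m\<close>.\<close>

lemma sum_mertens_quotients:
  assumes "T \<ge> 1"
  shows "(\<Sum>m=1..T. mertens (real T / real m)) = 1"
proof -
  have "(\<Sum>m=1..T. mertens (real T / real m)) =
        (\<Sum>n=1..T. real_of_int (\<Sum>d | d dvd n. moebius_mu d))"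
    using sum_moebius_mu_convolution[of "\<lambda>_. 1" T] by simp
  also have "\<dots> = (\<Sum>n=1..T. if n = 1 then 1 else 0)"
    by (intro sum.cong refl) (simp add: sum_divisors_moebius_mu)
  also have "\<dots> = 1" using assms by simp
  finally show ?thesis .
qed

lemma abs_mertens_le:
  assumes "t \<ge> 0"
  shows "\<bar>mertens t\<bar> \<le> t"
proof -
  have "\<bar>mertens t\<bar> \<le> (\<Sum>k\<in>{1..nat \<lfloor>t\<rfloor>}. 1)"
    unfolding mertens_def
    by (rule order_trans[OF sum_abs], rule sum_mono) (simp add: moebius_mu_def)
  also have "\<dots> \<le> t" using assms by simp
  finally show ?thesis .
qed

lemma card_multiples:
  fixes e N :: nat
  assumes "e > 0"
  shows "card {c \<in> {1..N}. e dvd c} = N div e"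
proof -
  have "bij_betw (\<lambda>k. e * k) {1..N div e} {c \<in> {1..N}. e dvd c}"
    by (rule bij_betw_byWitness[where f' = "\<lambda>c. c div e"])
      (use assms in \<open>auto simp: less_eq_div_iff_mult_less_eq Suc_le_eq mult.commute elim!: dvdE\<close>)
  from bij_betw_same_card[OF this] show ?thesis by simp
qed

text \<open>Coprimality is detected by summing \<open>moebius_mu\<close> over the common divisors
  \<open>e\<close>. Each \<open>e\<close> divides \<open>d\<close>, so the number of its multiples
  is an exact floor and no error term arises.\<close>

lemma card_coprime_upto:
  assumes "d > 0" "x \<ge> 0"
  shows "real (card {c \<in> {1..nat \<lfloor>x * real d\<rfloor>}. coprime c d}) =
         (\<Sum>e | e dvd d. moebius_mu e * real_of_int \<lfloor>x * real (d div e)\<rfloor>)"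
proof -
  define N where "N = nat \<lfloor>x * real d\<rfloor>"
  have fin: "finite {e. e dvd d}" using assms by simp
  have "int (card {c \<in> {1..N}. coprime c d}) = (\<Sum>c=1..N. if coprime c d then 1 else 0)"
    by (simp flip: sum.inter_filter)
  also have "\<dots> = (\<Sum>c=1..N. \<Sum>e | e dvd gcd c d. moebius_mu e)"
    using assms by (intro sum.cong refl)
      (subst sum_divisors_moebius_mu, auto simp: coprime_iff_gcd_eq_1)
  also have "\<dots> = (\<Sum>c=1..N. \<Sum>e | e dvd d. if e dvd c then moebius_mu e else 0)"
  proof (rule sum.cong[OF refl])
    fix c
    have "{e. e dvd gcd c d} = {e \<in> {e. e dvd d}. e dvd c}" by auto
    thus "(\<Sum>e | e dvd gcd c d. moebius_mu e) = (\<Sum>e | e dvd d. if e dvd c then moebius_mu e else 0)"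
      by (simp only: sum.inter_filter[OF fin])
  qed
  also have "\<dots> = (\<Sum>e | e dvd d. \<Sum>c=1..N. if e dvd c then moebius_mu e else 0)"
    by (rule sum.swap)
  also have "\<dots> = (\<Sum>e | e dvd d. moebius_mu e * int (N div e))"
  proof (intro sum.cong refl)
    fix e assume "e \<in> {e. e dvd d}"
    hence "e > 0" using assms by (auto intro: Nat.gr0I)
    have "(\<Sum>c=1..N. if e dvd c then moebius_mu e else 0) = (\<Sum>c\<in>{c \<in> {1..N}. e dvd c}. moebius_mu e)"
      by (rule sum.inter_filter[symmetric]) simp
    thus "(\<Sum>c=1..N. if e dvd c then moebius_mu e else 0) = moebius_mu e * int (N div e)"
      using card_multiples[OF \<open>e > 0\<close>, of N] by (simp only: sum_constant mult.commute)
  qed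
  also have "\<dots> = (\<Sum>e | e dvd d. moebius_mu e * \<lfloor>x * real (d div e)\<rfloor>)"
  proof (intro sum.cong refl)
    fix e assume "e \<in> {e. e dvd d}"
    then obtain k where k: "d = e * k" "e > 0" using assms by (auto elim!: dvdE)
    have "\<lfloor>x * real (d div e)\<rfloor> = \<lfloor>(x * real d) / real_of_int (int e)\<rfloor>" using k by simp
    \<comment> \<open>Nested floors collapse: rounding \<open>x * d\<close> down before the division
      by the integer \<open>e\<close> does not change the floor of the quotient.\<close>
    also have "\<dots> = \<lfloor>x * real d\<rfloor> div int e"
      by (rule floor_divide_real_eq_div) simp
    also have "\<dots> = int (N div e)" using assms by (simp add: N_def zdiv_int)
    finally show "moebius_mu e * int (N div e) = moebius_mu e * \<lfloor>x * real (d div e)\<rfloor>" by simp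
  qed
  finally have "real_of_int (int (card {c \<in> {1..N}. coprime c d})) =
      real_of_int (\<Sum>e | e dvd d. moebius_mu e * \<lfloor>x * real (d div e)\<rfloor>)" by (rule arg_cong)
  thus ?thesis by (simp add: N_def)
qed

section \<open>Counting Farey fractions in \<open>[1 - x, 1]\<close>\<close>

lemma mem_farey_iff:
  "\<xi> \<in> farey T \<longleftrightarrow> (\<exists>a b. \<xi> = real a / real b \<and> a < b \<and> b \<le> T \<and> coprime a b)"
proof
  assume "\<xi> \<in> farey T"
  then obtain a b where "\<xi> = real_of_int a / real_of_int b" "0 \<le> a" "a < b" "b \<le> int T" "coprime a b"
    by (auto simp: farey_def)
  thus "\<exists>a b. \<xi> = real a / real b \<and> a < b \<and> b \<le> T \<and> coprime a b"
    by (intro exI[of _ "nat a"] exI[of _ "nat b"]) (auto simp: coprime_int_iff simp flip: coprime_int_iff)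
next
  assume "\<exists>a b. \<xi> = real a / real b \<and> a < b \<and> b \<le> T \<and> coprime a b"
  then obtain a b where "\<xi> = real a / real b" "a < b" "b \<le> T" "coprime a b" by auto
  thus "\<xi> \<in> farey T"
    unfolding farey_def
    by (intro CollectI exI[of _ "int a"] exI[of _ "int b"]) auto
qed

lemma coprime_diff_self_nat:
  fixes c d :: nat
  assumes "coprime c d" "c \<le> d"
  shows "coprime (d - c) d"
proof (rule coprimeI)
  fix k assume k: "k dvd d - c" "k dvd d"
  hence "k dvd c" using assms(2) by (rule dvd_diffD1)
  thus "is_unit k" using k(2) assms(1) coprime_common_divisor[of c d k] by simp
qed

text \<open>The pair \<open>(d, c)\<close> encodes the reflection of \<open>c / d\<close>. Starting
  at \<open>c = 1\<close> leaves out the value 1, which is no element of \<open>farey T\<close>, and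
  coprimality allows \<open>c = d\<close> only for \<open>d = 1\<close>, giving 0. Uniqueness of
  lowest terms gives injectivity.\<close>

lemma bij_betw_farey_upper:
  assumes "0 \<le> x" "x \<le> 1"
  shows "bij_betw (\<lambda>(d, c). 1 - real c / real d)
           (SIGMA d:{1..T}. {c \<in> {1..nat \<lfloor>x * real d\<rfloor>}. coprime c d}) (farey T \<inter> {1 - x..1})"
  unfolding bij_betw_def
proof
  show "inj_on (\<lambda>(d, c). 1 - real c / real d)
          (SIGMA d:{1..T}. {c \<in> {1..nat \<lfloor>x * real d\<rfloor>}. coprime c d})"
  proof (rule inj_onI, clarsimp)
    fix d c d' c' :: nat
    assume *: "real c / real d = real c' / real d'" "Suc 0 \<le> d" "Suc 0 \<le> d'"
      "coprime c d" "coprime c' d'"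
    hence "real (c * d') = real (c' * d)" by (simp add: field_simps)
    hence "c * d' = c' * d" by (simp only: of_nat_eq_iff)
    thus "d = d' \<and> c = c'"
      using * coprime_crossproduct_nat[of c d c' d'] by auto
  qed
  show "(\<lambda>(d, c). 1 - real c / real d) `
      (SIGMA d:{1..T}. {c \<in> {1..nat \<lfloor>x * real d\<rfloor>}. coprime c d}) = farey T \<inter> {1 - x..1}"
  proof (intro equalityI subsetI)
    fix \<xi> assume "\<xi> \<in> (\<lambda>(d, c). 1 - real c / real d) `
      (SIGMA d:{1..T}. {c \<in> {1..nat \<lfloor>x * real d\<rfloor>}. coprime c d})"
    then obtain d c where dc: "\<xi> = 1 - real c / real d" "1 \<le> d" "d \<le> T" "1 \<le> c"
      "c \<le> nat \<lfloor>x * real d\<rfloor>" "coprime c d" by auto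
    have cx: "real c \<le> x * real d" using dc(4,5) by linarith
    also have "\<dots> \<le> 1 * real d" using assms by (intro mult_right_mono) auto
    finally have cd: "c \<le> d" by simp
    have "coprime (d - c) d" using dc(6) cd by (rule coprime_diff_self_nat)
    moreover have "\<xi> = real (d - c) / real d" using dc cd by (simp add: field_simps)
    ultimately have "\<xi> \<in> farey T" using dc cd
      unfolding mem_farey_iff by (intro exI[of _ "d - c"] exI[of _ d]) auto
    moreover have "real c / real d \<le> x" using cx dc(2) by (simp add: field_simps)
    ultimately show "\<xi> \<in> farey T \<inter> {1 - x..1}" using dc(1) by simp
  next
    fix \<xi> assume \<xi>: "\<xi> \<in> farey T \<inter> {1 - x..1}"
    then obtain a b where ab: "\<xi> = real a / real b" "a < b" "b \<le> T" "coprime a b"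
      by (auto simp: mem_farey_iff)
    have 1: "\<xi> = 1 - real (b - a) / real b" using ab by (simp add: field_simps)
    hence "real (b - a) / real b \<le> x" using \<xi> by simp
    hence "real (b - a) \<le> x * real b" using ab by (simp add: field_simps)
    hence 2: "b - a \<le> nat \<lfloor>x * real b\<rfloor>" by (simp add: le_nat_floor)
    have "coprime (b - a) b" using ab by (intro coprime_diff_self_nat) auto
    hence "(b, b - a) \<in> (SIGMA d:{1..T}. {c \<in> {1..nat \<lfloor>x * real d\<rfloor>}. coprime c d})"
      using 2 ab by auto
    thus "\<xi> \<in> (\<lambda>(d, c). 1 - real c / real d) `
        (SIGMA d:{1..T}. {c \<in> {1..nat \<lfloor>x * real d\<rfloor>}. coprime c d})"
      using 1 by force
  qed
qed

text \<open>Count for each denominator \<open>d\<close> separately, then regroup by the cofactor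
  \<open>m = d div e\<close>.\<close>

lemma card_farey_upper:
  assumes "0 \<le> x" "x \<le> 1"
  shows "real (card (farey T \<inter> {1 - x..1})) =
         (\<Sum>m=1..T. real_of_int \<lfloor>x * real m\<rfloor> * mertens (real T / real m))"
proof -
  have "real (card (farey T \<inter> {1 - x..1})) =
      (\<Sum>d=1..T. real (card {c \<in> {1..nat \<lfloor>x * real d\<rfloor>}. coprime c d}))"
    using bij_betw_same_card[OF bij_betw_farey_upper[OF assms, of T]] by (simp flip: of_nat_sum)
  also have "\<dots> = (\<Sum>d=1..T. \<Sum>e | e dvd d. moebius_mu e * real_of_int \<lfloor>x * real (d div e)\<rfloor>)"
    using assms by (intro sum.cong refl card_coprime_upto) auto
  also have "\<dots> = (\<Sum>m=1..T. real_of_int \<lfloor>x * real m\<rfloor> * mertens (real T / real m))"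
    by (rule sum_moebius_mu_convolution[of "\<lambda>m. real_of_int \<lfloor>x * real m\<rfloor>"])
  finally show ?thesis .
qed

lemma farey_bounds: "\<xi> \<in> farey T \<Longrightarrow> 0 \<le> \<xi> \<and> \<xi> < 1"
  by (auto simp: mem_farey_iff)

lemma finite_farey: "finite (farey T)"
proof -
  have "farey T \<inter> {1 - 1..1} = farey T" using farey_bounds by force
  moreover have "finite (farey T \<inter> {1 - 1..1})"
    using bij_betw_finite[OF bij_betw_farey_upper[of 1 T]] by simp
  ultimately show ?thesis by simp
qed

text \<open>The case \<open>x = 1\<close> of \<open>card_farey_upper\<close>, in which the floor
  disappears. Both counts thus carry the same Mertens weights.\<close>

lemma farey_count_eq: "farey_count T = (\<Sum>m=1..T. real m * mertens (real T / real m))"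
proof -
  have "farey T \<inter> {1 - 1..1} = farey T" using farey_bounds by force
  thus ?thesis using card_farey_upper[of 1 T] by (simp add: farey_count_def)
qed

text \<open>Since the weights agree, subtracting \<open>\<xi>\<^sup>2 * m\<close> from its floor
  term by term leaves exactly minus the fractional part.\<close>

lemma farey_C_minus_eq:
  "farey_C T - farey_count T * farey_G T =
     - (\<Sum>m=1..T. mertens (real T / real m) * (\<Sum>\<xi>\<in>{\<xi>\<in>farey T. \<xi> \<le> 1/2}. frac (real m * \<xi>\<^sup>2)))"
proof -
  define A where "A = {\<xi>\<in>farey T. \<xi> \<le> 1/2}"
  have A: "farey T \<inter> {0..1/2} = A" using farey_bounds by (auto simp: A_def)
  have "farey_C T = (\<Sum>\<xi>\<in>A. \<Sum>m=1..T. real_of_int \<lfloor>\<xi>\<^sup>2 * real m\<rfloor> * mertens (real T / real m))"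
    unfolding farey_C_def A
  proof (intro sum.cong refl)
    fix \<xi> assume "\<xi> \<in> A"
    hence "0 \<le> \<xi>\<^sup>2" "\<xi>\<^sup>2 \<le> 1" using farey_bounds[of \<xi> T] by (auto simp: A_def power_le_one)
    thus "real (card (farey T \<inter> {1 - \<xi>\<^sup>2..1})) =
        (\<Sum>m=1..T. real_of_int \<lfloor>\<xi>\<^sup>2 * real m\<rfloor> * mertens (real T / real m))"
      by (rule card_farey_upper)
  qed
  moreover have "farey_count T * farey_G T =
      (\<Sum>\<xi>\<in>A. \<Sum>m=1..T. \<xi>\<^sup>2 * real m * mertens (real T / real m))"
  proof -
    have "farey_count T * farey_G T = (\<Sum>\<xi>\<in>A. farey_count T * \<xi>\<^sup>2)"
      by (simp only: farey_G_def A_def sum_distrib_left)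
    also have "\<dots> = (\<Sum>\<xi>\<in>A. \<Sum>m=1..T. \<xi>\<^sup>2 * real m * mertens (real T / real m))"
      unfolding farey_count_eq sum_distrib_right by (intro sum.cong refl) (simp only: mult_ac)
    finally show ?thesis .
  qed
  ultimately have "farey_C T - farey_count T * farey_G T =
      (\<Sum>\<xi>\<in>A. \<Sum>m=1..T. real_of_int \<lfloor>\<xi>\<^sup>2 * real m\<rfloor> * mertens (real T / real m) -
         \<xi>\<^sup>2 * real m * mertens (real T / real m))"
    by (simp only: sum_subtractf)
  also have "\<dots> = (\<Sum>\<xi>\<in>A. \<Sum>m=1..T. - (mertens (real T / real m) * frac (real m * \<xi>\<^sup>2)))"
    by (intro sum.cong refl) (simp add: frac_def algebra_simps)
  also have "\<dots> = (\<Sum>m=1..T. \<Sum>\<xi>\<in>A. - (mertens (real T / real m) * frac (real m * \<xi>\<^sup>2)))"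
    by (rule sum.swap)
  also have "\<dots> = - (\<Sum>m=1..T. mertens (real T / real m) * (\<Sum>\<xi>\<in>A. frac (real m * \<xi>\<^sup>2)))"
    by (simp only: sum_negf sum_distrib_left)
  finally show ?thesis by (simp add: A_def)
qed

section \<open>Fejer means of the sawtooth\<close>

lemma sin_pi_mult_ge:
  assumes "0 \<le> y" "y \<le> 1/2"
  shows "2 * y \<le> sin (pi * y)"
proof -
  have "concave_on {0..1/2} (\<lambda>y. sin (pi * y))"
  proof (rule f''_le0_imp_concave)
    fix y :: real assume y: "y \<in> {0..1/2}"
    show "((\<lambda>y. sin (pi * y)) has_real_derivative pi * cos (pi * y)) (at y)"
      by (auto intro!: derivative_eq_intros)
    show "((\<lambda>y. pi * cos (pi * y)) has_real_derivative - (pi\<^sup>2 * sin (pi * y))) (at y)"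
      by (auto intro!: derivative_eq_intros simp: power2_eq_square)
    have "pi * y \<le> pi" using y by simp
    thus "- (pi\<^sup>2 * sin (pi * y)) \<le> 0" using y by (simp add: sin_ge_zero)
  qed auto
  \<comment> \<open>Concavity puts the graph above its chord from \<open>(0, 0)\<close> to
    \<open>(1/2, 1)\<close>; the chord parameter \<open>2 * y\<close> corresponds to the abscissa
    \<open>y\<close>.\<close>
  from concave_onD_Icc[OF this, of "2 * y"] show ?thesis using assms by simp
qed

text \<open>Multiplication by \<open>sin x\<close> turns each cosine into a difference of
  consecutive sines, so the sum telescopes.\<close>

lemma dirichlet_kernel:
  fixes x :: real
  shows "sin x * (1 + 2 * (\<Sum>h=1..n. cos (2 * real h * x))) = sin ((2 * real n + 1) * x)"
proof (induction n)
  case (Suc n)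
  have "sin ((2 * real (Suc n) + 1) * x) - sin ((2 * real n + 1) * x) = 2 * sin x * cos (2 * real (Suc n) * x)"
  proof -
    have "((2 * real (Suc n) + 1) * x - (2 * real n + 1) * x) / 2 = x"
      "((2 * real (Suc n) + 1) * x + (2 * real n + 1) * x) / 2 = 2 * real (Suc n) * x"
      by (simp_all add: algebra_simps)
    thus ?thesis by (simp only: sin_diff_sin)
  qed
  with Suc.IH show ?case by (simp add: algebra_simps)
qed simp

text \<open>Passing from \<open>H\<close> to \<open>Suc H\<close> adds the Dirichlet kernel of order
  \<open>H\<close>, and \<open>sin x * sin ((2 * H + 1) * x)\<close> is the difference of the
  squares of \<open>sin ((H + 1) * x)\<close> and \<open>sin (H * x)\<close>.\<close>

lemma fejer_kernel:
  fixes x :: real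
  shows "(sin x)\<^sup>2 * (real H + 2 * (\<Sum>h=1..<H. (real H - real h) * cos (2 * real h * x))) = (sin (real H * x))\<^sup>2"
proof (induction H)
  case (Suc H)
  let ?c = "\<lambda>h. cos (2 * real h * x)"
  have "(\<Sum>h=1..<Suc H. (real (Suc H) - real h) * ?c h) = (\<Sum>h=1..H. (real H - real h) * ?c h) + (\<Sum>h=1..H. ?c h)"
    by (simp add: atLeastLessThanSuc_atLeastAtMost algebra_simps flip: sum.distrib)
  also have "(\<Sum>h=1..H. (real H - real h) * ?c h) = (\<Sum>h=1..<H. (real H - real h) * ?c h)"
    by (cases H) (auto simp: atLeastLessThanSuc_atLeastAtMost)
  finally have *: "real (Suc H) + 2 * (\<Sum>h=1..<Suc H. (real (Suc H) - real h) * ?c h) =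
     (real H + 2 * (\<Sum>h=1..<H. (real H - real h) * ?c h)) + (1 + 2 * (\<Sum>h=1..H. ?c h))" by simp
  have "(sin x)\<^sup>2 * (real (Suc H) + 2 * (\<Sum>h=1..<Suc H. (real (Suc H) - real h) * ?c h)) =
     (sin x)\<^sup>2 * (real H + 2 * (\<Sum>h=1..<H. (real H - real h) * ?c h)) +
     sin x * (sin x * (1 + 2 * (\<Sum>h=1..H. ?c h)))"
    unfolding * by (subst distrib_left) (simp only: power2_eq_square mult.assoc)
  also have "\<dots> = (sin (real H * x))\<^sup>2 + sin x * sin ((2 * real H + 1) * x)"
    by (simp only: dirichlet_kernel Suc.IH)
  also have "sin x * sin ((2 * real H + 1) * x) = (sin (real (Suc H) * x))\<^sup>2 - (sin (real H * x))\<^sup>2"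
  proof -
    have "(sin (real (Suc H) * x))\<^sup>2 - (sin (real H * x))\<^sup>2 =
        (sin (real (Suc H) * x) + sin (real H * x)) * (sin (real (Suc H) * x) - sin (real H * x))"
      by (simp add: power2_eq_square algebra_simps)
    also have "\<dots> = (2 * sin ((2 * real H + 1) * x / 2) * cos (x / 2)) * (2 * sin (x / 2) * cos ((2 * real H + 1) * x / 2))"
      by (subst sin_plus_sin, subst sin_diff_sin) (simp add: algebra_simps)
    also have "\<dots> = (2 * sin (x / 2) * cos (x / 2)) *
        (2 * sin ((2 * real H + 1) * x / 2) * cos ((2 * real H + 1) * x / 2))"
      by simp
    also have "\<dots> = sin x * sin ((2 * real H + 1) * x)"
      using sin_double[of "x/2"] sin_double[of "(2 * real H + 1) * x / 2"] by simp
    finally show ?thesis by simp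
  qed
  finally show ?case by simp
qed simp

text \<open>The Cesaro mean of order \<open>H\<close> of the Fourier series of
  \<open>1/2 - frac y\<close>, hence an approximation to the negative of the sawtooth.\<close>

definition fejer_saw :: "nat \<Rightarrow> real \<Rightarrow> real" where
  "fejer_saw H y = (\<Sum>h=1..<H. (1 - real h / real H) / (pi * real h) * sin (2 * pi * real h * y))"

text \<open>The Fejer kernel of period 1. Up to the constant 1 it is the derivative of
  \<open>fejer_saw\<close>, which is how its positivity comes into play.\<close>

definition fejer :: "nat \<Rightarrow> real \<Rightarrow> real" where
  "fejer H y = 1 + 2 * (\<Sum>h=1..<H. (1 - real h / real H) * cos (2 * pi * real h * y))"

lemma fejer_saw_deriv:
  "(fejer_saw H has_real_derivative (fejer H y - 1)) (at y)"
  unfolding fejer_saw_def fejer_def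
  by (auto intro!: derivative_eq_intros sum.cong simp: sum_distrib_left)

lemma fejer_eq:
  assumes "H > 0" "sin (pi * y) \<noteq> 0"
  shows "fejer H y = (sin (pi * real H * y))\<^sup>2 / (real H * (sin (pi * y))\<^sup>2)"
proof -
  have "real H * fejer H y = real H + 2 * (\<Sum>h=1..<H. (real H - real h) * cos (2 * real h * (pi * y)))"
    using assms(1) unfolding fejer_def distrib_left sum_distrib_left
    by (intro arg_cong2[of _ _ _ _ "(+)"] sum.cong) (auto simp: field_simps)
  hence "(sin (pi * y))\<^sup>2 * (real H * fejer H y) = (sin (real H * (pi * y)))\<^sup>2"
    by (simp only: fejer_kernel)
  thus ?thesis using assms by (simp add: field_simps)
qed

text \<open>The closed form is a quotient of squares, hence nonnegative; the chord bound for the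
  sine controls its denominator.\<close>

lemma fejer_bounds:
  assumes "H > 0" "0 < y" "y \<le> 1/2"
  shows "0 \<le> fejer H y" "fejer H y \<le> 1 / (4 * real H * y\<^sup>2)"
proof -
  have s: "2 * y \<le> sin (pi * y)" using assms by (intro sin_pi_mult_ge) auto
  hence s0: "sin (pi * y) > 0" using assms by linarith
  show "0 \<le> fejer H y" using assms s0 by (simp add: fejer_eq)
  have "(2 * y)\<^sup>2 \<le> (sin (pi * y))\<^sup>2" using s assms by (intro power_mono) auto
  moreover have "(sin (pi * real H * y))\<^sup>2 \<le> 1" by (simp add: abs_square_le_1)
  ultimately have "(sin (pi * real H * y))\<^sup>2 / (real H * (sin (pi * y))\<^sup>2) \<le> 1 / (real H * (2 * y)\<^sup>2)"
    using assms by (intro frac_le mult_left_mono mult_pos_pos) auto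
  thus "fejer H y \<le> 1 / (4 * real H * y\<^sup>2)" using assms s0 by (simp add: fejer_eq power_mult_distrib mult_ac)
qed

lemma fejer_saw_half: "fejer_saw H (1/2) = 0"
proof -
  have "sin (2 * pi * real h * (1/2)) = 0" for h :: nat
    using sin_npi[of h] by (simp add: mult.commute)
  thus ?thesis by (simp only: fejer_saw_def mult_zero_right sum.neutral_const)
qed

lemma fejer_saw_zero: "fejer_saw H 0 = 0"
  by (simp add: fejer_saw_def)

lemma fejer_saw_one_minus: "fejer_saw H (1 - y) = - fejer_saw H y"
proof -
  have "sin (2 * pi * real h * (1 - y)) = - sin (2 * pi * real h * y)" for h :: nat
    using sin_diff[of "2 * pi * real h" "2 * pi * real h * y"] sin_npi[of "2 * h"] cos_2npi[of h]
    by (simp add: right_diff_distrib mult_ac)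
  thus ?thesis by (simp add: fejer_saw_def sum_negf)
qed

lemma fejer_saw_frac: "fejer_saw H (frac y) = fejer_saw H y"
proof -
  have "sin (2 * pi * real h * frac y) = sin (2 * pi * real h * y)" for h :: nat
  proof -
    have "2 * pi * real h * frac y = 2 * pi * real h * y - 2 * pi * of_int (int h * \<lfloor>y\<rfloor>)"
      by (simp add: frac_def algebra_simps)
    thus ?thesis
      using sin_int_2pin[of "int h * \<lfloor>y\<rfloor>"] cos_int_2pin[of "int h * \<lfloor>y\<rfloor>"] by (simp only: sin_diff)
  qed
  thus ?thesis by (simp add: fejer_saw_def)
qed

text \<open>The function \<open>x + fejer_saw H x\<close> has derivative
  \<open>fejer H x \<ge> 0\<close>, so comparing with its values at \<open>1/2\<close> and
  \<open>0\<close> gives the first two bounds. Adding \<open>1 / (4 * H * x)\<close>, whose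
  derivative outweighs the kernel bound, gives a decreasing function and the third.\<close>

lemma fejer_saw_approx_half:
  assumes "H > 0" "0 < y" "y \<le> 1/2"
  shows "fejer_saw H y \<le> 1/2 - y" "- y \<le> fejer_saw H y"
    "1/2 - y - 1 / (4 * real H * y) \<le> fejer_saw H y"
proof -
  have cont: "continuous_on A (fejer_saw H)" for A
    by (rule DERIV_continuous_on) (rule has_field_derivative_at_within, rule fejer_saw_deriv)
  have "y + fejer_saw H y \<le> 1/2 + fejer_saw H (1/2)"
  proof (rule DERIV_nonneg_imp_increasing_open[where f = "\<lambda>x. x + fejer_saw H x"])
    fix x assume "y < x" "x < 1/2"
    thus "\<exists>d. ((\<lambda>x. x + fejer_saw H x) has_real_derivative d) (at x) \<and> 0 \<le> d"
      using assms fejer_bounds(1)[of H x]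
      by (intro exI[of _ "1 + (fejer H x - 1)"]) (intro conjI DERIV_add DERIV_ident fejer_saw_deriv, simp)
  qed (use assms in \<open>auto intro!: continuous_intros cont\<close>)
  thus "fejer_saw H y \<le> 1/2 - y" by (simp add: fejer_saw_half)
  have "0 + fejer_saw H 0 \<le> y + fejer_saw H y"
  proof (rule DERIV_nonneg_imp_increasing_open[where f = "\<lambda>x. x + fejer_saw H x"])
    fix x assume "0 < x" "x < y"
    thus "\<exists>d. ((\<lambda>x. x + fejer_saw H x) has_real_derivative d) (at x) \<and> 0 \<le> d"
      using assms fejer_bounds(1)[of H x]
      by (intro exI[of _ "1 + (fejer H x - 1)"]) (intro conjI DERIV_add DERIV_ident fejer_saw_deriv, simp)
  qed (use assms in \<open>auto intro!: continuous_intros cont\<close>)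
  thus "- y \<le> fejer_saw H y" by (simp add: fejer_saw_zero)
  have "1/2 + fejer_saw H (1/2) + 1 / (4 * real H * (1/2)) \<le> y + fejer_saw H y + 1 / (4 * real H * y)"
  proof (rule DERIV_nonpos_imp_decreasing_open[where f = "\<lambda>x. x + fejer_saw H x + 1 / (4 * real H * x)"])
    fix x assume x: "y < x" "x < 1/2"
    have "((\<lambda>x. 1 / (4 * real H * x)) has_real_derivative - (1 / (4 * real H * x\<^sup>2))) (at x)"
      using assms x by (auto intro!: derivative_eq_intros simp: field_simps power2_eq_square)
    hence "((\<lambda>x. x + fejer_saw H x + 1 / (4 * real H * x)) has_real_derivative
        1 + (fejer H x - 1) + - (1 / (4 * real H * x\<^sup>2))) (at x)"
      by (intro DERIV_add DERIV_ident fejer_saw_deriv)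
    thus "\<exists>d. ((\<lambda>x. x + fejer_saw H x + 1 / (4 * real H * x)) has_real_derivative d) (at x) \<and> d \<le> 0"
      using x assms fejer_bounds(2)[of H x] by (intro exI conjI) auto
  qed (use assms in \<open>auto intro!: continuous_intros cont\<close>)
  moreover have "0 \<le> 1 / (4 * real H * (1/2))" by simp
  ultimately show "1/2 - y - 1 / (4 * real H * y) \<le> fejer_saw H y"
    unfolding fejer_saw_half by linarith
qed

text \<open>The right half of the period follows from the left one by
  \<open>fejer_saw_one_minus\<close>.\<close>

lemma fejer_saw_approx:
  assumes "H > 0" "0 < D" "D \<le> t" "t \<le> 1 - D"
  shows "\<bar>fejer_saw H t - (1/2 - t)\<bar> \<le> 1 / (4 * real H * D)"
proof -
  have *: "\<bar>fejer_saw H s - (1/2 - s)\<bar> \<le> 1 / (4 * real H * D)" if "D \<le> s" "s \<le> 1/2" for s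
  proof -
    have "1 / (4 * real H * s) \<le> 1 / (4 * real H * D)"
      using that assms by (intro divide_left_mono mult_left_mono mult_pos_pos) auto
    thus ?thesis using fejer_saw_approx_half(1,3)[of H s] that assms by linarith
  qed
  show ?thesis
  proof (cases "t \<le> 1/2")
    case False
    thus ?thesis using *[of "1 - t"] assms fejer_saw_one_minus[of H t] by linarith
  qed (use * assms in auto)
qed

text \<open>Positivity of the kernel rules out any overshoot at the jump:
  \<open>- y \<le> fejer_saw H y \<le> 1/2 - y\<close> holds on half a period and extends by oddness
  and periodicity.\<close>

lemma abs_fejer_saw_le:
  assumes "H > 0"
  shows "\<bar>fejer_saw H y\<bar> \<le> 1/2"
proof -
  have *: "\<bar>fejer_saw H s\<bar> \<le> 1/2" if "0 < s" "s \<le> 1/2" for s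
    using fejer_saw_approx_half[OF assms that] that by linarith
  define t where "t = frac y"
  have t: "0 \<le> t" "t < 1" by (auto simp: t_def frac_lt_1)
  have "\<bar>fejer_saw H t\<bar> \<le> 1/2"
  proof (cases "t = 0 \<or> t \<le> 1/2")
    case True
    thus ?thesis using * t fejer_saw_zero by (cases "t = 0") auto
  next
    case False
    thus ?thesis using *[of "1 - t"] t fejer_saw_one_minus[of H t] by simp
  qed
  thus ?thesis by (simp add: t_def fejer_saw_frac)
qed

text \<open>The Fejer means approximate the sawtooth badly near its jump. Since the sawtooth increases with
  slope \<open>1\<close> and only jumps downwards, a shift by \<open>D\<close> in the favourable direction removes this
  problem at the cost of \<open>O(D)\<close>.\<close>

lemma sawtooth_le_fejer_saw:
  assumes "H > 0" "0 < D" "D \<le> 1/4"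
  shows "frac y - 1/2 \<le> - fejer_saw H (y - D) + 2 * D + 1 / (4 * real H * D)"
proof -
  define t where "t = frac (y - D)"
  have t: "0 \<le> t" "t < 1" "y - D = of_int \<lfloor>y - D\<rfloor> + t" unfolding t_def by (rule frac_ge_0, rule frac_lt_1, simp add: frac_def)
  have V: "fejer_saw H (y - D) = fejer_saw H t" by (simp add: t_def fejer_saw_frac)
  have pos: "0 \<le> 1 / (4 * real H * D)" using assms by simp
  have "\<lfloor>y - D\<rfloor> \<le> \<lfloor>y\<rfloor>" using assms by (intro floor_mono) auto
  hence le: "frac y \<le> t + D" unfolding t_def frac_def by linarith
  \<comment> \<open>Only the middle range uses the approximation. In the outer ones
    \<open>frac y\<close> is below \<open>2 * D\<close>, so the bound \<open>1/2\<close> for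
    \<open>fejer_saw\<close> suffices; for \<open>t > 1 - D\<close> this is because \<open>y\<close>
    has passed the next integer.\<close>
  consider "t < D" | "D \<le> t" "t \<le> 1 - D" | "t > 1 - D" by linarith
  thus ?thesis
  proof cases
    case 1
    thus ?thesis using le abs_fejer_saw_le[OF assms(1), of t] V pos by linarith
  next
    case 2
    thus ?thesis using le fejer_saw_approx[OF assms(1,2) 2] V assms by linarith
  next
    case 3
    have "frac y = t + D - 1"
      unfolding frac_unique_iff
    proof (intro conjI)
      have "y - (t + D - 1) = of_int (\<lfloor>y - D\<rfloor> + 1)" using t(3) by simp
      thus "y - (t + D - 1) \<in> \<int>" by (metis Ints_of_int)
    qed (use 3 t assms in linarith)+
    thus ?thesis using abs_fejer_saw_le[OF assms(1), of t] V pos t(2) assms by linarith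
  qed
qed

lemma sawtooth_ge_fejer_saw:
  assumes "H > 0" "0 < D" "D \<le> 1/4"
  shows "frac y - 1/2 \<ge> - fejer_saw H (y + D) - 2 * D - 1 / (4 * real H * D)"
proof -
  define t where "t = frac (y + D)"
  have t: "0 \<le> t" "t < 1" "y + D = of_int \<lfloor>y + D\<rfloor> + t" unfolding t_def by (rule frac_ge_0, rule frac_lt_1, simp add: frac_def)
  have V: "fejer_saw H (y + D) = fejer_saw H t" by (simp add: t_def fejer_saw_frac)
  have pos: "0 \<le> 1 / (4 * real H * D)" using assms by simp
  have "\<lfloor>y\<rfloor> \<le> \<lfloor>y + D\<rfloor>" using assms by (intro floor_mono) auto
  hence le: "t - D \<le> frac y" unfolding t_def frac_def by linarith
  \<comment> \<open>Mirror image of the upper bound: in the outer ranges \<open>frac y\<close>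
    exceeds \<open>1 - 2 * D\<close>.\<close>
  consider "t < D" | "D \<le> t" "t \<le> 1 - D" | "t > 1 - D" by linarith
  thus ?thesis
  proof cases
    case 1
    have "frac y = t - D + 1"
      unfolding frac_unique_iff
    proof (intro conjI)
      have "y - (t - D + 1) = of_int (\<lfloor>y + D\<rfloor> - 1)" using t(3) by simp
      thus "y - (t - D + 1) \<in> \<int>" by (metis Ints_of_int)
    qed (use 1 t assms in linarith)+
    thus ?thesis using abs_fejer_saw_le[OF assms(1), of t] V pos t(1) assms by linarith
  next
    case 2
    thus ?thesis using le fejer_saw_approx[OF assms(1,2) 2] V assms by linarith
  next
    case 3
    thus ?thesis using le abs_fejer_saw_le[OF assms(1), of t] V pos by linarith
  qed
qed

text \<open>The shift \<open>c\<close> only multiplies the exponential sum of frequency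
  \<open>h\<close> by a number of modulus 1, so the bound is independent of \<open>c\<close>. The
  sine sums are imaginary parts of these products.\<close>

lemma abs_sum_fejer_saw_le:
  fixes y :: "'a \<Rightarrow> real"
  shows "\<bar>\<Sum>r\<in>S. fejer_saw H (y r + c)\<bar> \<le>
     (\<Sum>h=1..<H. 1 / real h * cmod (\<Sum>r\<in>S. cis (2 * pi * real h * y r)))"
proof -
  let ?w = "\<lambda>h::nat. (1 - real h / real H) / (pi * real h)"
  let ?X = "\<lambda>h::nat. \<Sum>r\<in>S. sin (2 * pi * real h * (y r + c))"
  let ?E = "\<lambda>h::nat. \<Sum>r\<in>S. cis (2 * pi * real h * y r)"
  have X: "\<bar>?X h\<bar> \<le> cmod (?E h)" for h
  proof -
    have "cis (2 * pi * real h * c) * cis (2 * pi * real h * y r) = cis (2 * pi * real h * (y r + c))" for r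
      by (simp only: cis_mult distrib_left add.commute)
    hence "?X h = Im (cis (2 * pi * real h * c) * ?E h)"
      by (simp only: sum_distrib_left Im_sum cis.sel)
    moreover have "cmod (cis (2 * pi * real h * c) * ?E h) = cmod (?E h)"
      by (simp only: norm_mult norm_cis mult_1_left)
    ultimately show ?thesis using abs_Im_le_cmod by metis
  qed
  have w: "\<bar>?w h\<bar> \<le> 1 / real h" if h: "h \<in> {1..<H}" for h
  proof -
    have "1 * real h \<le> pi * real h" by (rule mult_right_mono) (use pi_ge_two in linarith, simp)
    moreover have "1 - real h / real H \<le> 1" by simp
    ultimately have "?w h \<le> 1 / real h" using h by (intro frac_le) auto
    moreover have "0 \<le> ?w h" using h by simp
    ultimately show ?thesis by simp
  qed
  have "(\<Sum>r\<in>S. fejer_saw H (y r + c)) = (\<Sum>h=1..<H. ?w h * ?X h)"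
    unfolding fejer_saw_def by (subst sum.swap) (simp only: sum_distrib_left)
  hence "\<bar>\<Sum>r\<in>S. fejer_saw H (y r + c)\<bar> \<le> (\<Sum>h=1..<H. \<bar>?w h * ?X h\<bar>)"
    by (simp only: sum_abs)
  moreover have "(\<Sum>h=1..<H. \<bar>?w h * ?X h\<bar>) \<le> (\<Sum>h=1..<H. 1 / real h * cmod (?E h))"
  proof (rule sum_mono)
    fix h assume h: "h \<in> {1..<H}"
    show "\<bar>?w h * ?X h\<bar> \<le> 1 / real h * cmod (?E h)"
      unfolding abs_mult using w[OF h] X[of h] by (intro mult_mono) auto
  qed
  ultimately show ?thesis by linarith
qed

text \<open>The upper and the lower estimate use the shifts \<open>- D\<close> and \<open>D\<close>;
  both lead to the same exponential sums.\<close>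

lemma abs_sum_sawtooth_le:
  fixes y :: "'a \<Rightarrow> real"
  assumes "H > 0" "0 < D" "D \<le> 1/4"
  shows "\<bar>\<Sum>r\<in>S. frac (y r) - 1/2\<bar> \<le> real (card S) * (2 * D + 1 / (4 * real H * D)) +
     (\<Sum>h=1..<H. 1 / real h * cmod (\<Sum>r\<in>S. cis (2 * pi * real h * y r)))"
proof -
  let ?e = "2 * D + 1 / (4 * real H * D)"
  have "(\<Sum>r\<in>S. frac (y r) - 1/2) \<le> (\<Sum>r\<in>S. - fejer_saw H (y r + (- D)) + ?e)"
    using sawtooth_le_fejer_saw[OF assms] by (intro sum_mono) (simp only: add.assoc diff_conv_add_uminus)
  also have "\<dots> = - (\<Sum>r\<in>S. fejer_saw H (y r + (- D))) + real (card S) * ?e"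
    by (simp only: sum.distrib sum_negf sum_constant distrib_left)
  finally have 1: "(\<Sum>r\<in>S. frac (y r) - 1/2) \<le> - (\<Sum>r\<in>S. fejer_saw H (y r + (- D))) + real (card S) * ?e" .
  have "(\<Sum>r\<in>S. frac (y r) - 1/2) \<ge> (\<Sum>r\<in>S. - fejer_saw H (y r + D) - ?e)"
    using sawtooth_ge_fejer_saw[OF assms] by (intro sum_mono) (simp only: diff_diff_eq)
  also have "(\<Sum>r\<in>S. - fejer_saw H (y r + D) - ?e) = - (\<Sum>r\<in>S. fejer_saw H (y r + D)) - real (card S) * ?e"
    by (simp only: sum_subtractf sum_negf sum_constant sum.distrib distrib_left)
  finally have 2: "(\<Sum>r\<in>S. frac (y r) - 1/2) \<ge> - (\<Sum>r\<in>S. fejer_saw H (y r + D)) - real (card S) * ?e" .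
  show ?thesis
    using 1 2 abs_sum_fejer_saw_le[where S = S and H = H and y = y and c = "- D"] abs_sum_fejer_saw_le[where S = S and H = H and y = y and c = D] by linarith
qed

section \<open>Mean squares of exponential sums\<close>

lemma norm_one_minus_cis: "cmod (1 - cis (2 * x)) = 2 * \<bar>sin x\<bar>"
proof -
  have "(cmod (1 - cis (2 * x)))\<^sup>2 = (1 - cos (2 * x))\<^sup>2 + (sin (2 * x))\<^sup>2"
    by (simp add: cmod_power2)
  also have "\<dots> = 2 * (1 - cos (2 * x))"
    using sin_cos_squared_add[of "2 * x"] by (simp add: power2_eq_square algebra_simps)
  also have "\<dots> = (2 * \<bar>sin x\<bar>)\<^sup>2"
    by (simp add: cos_double_sin power_mult_distrib)
  finally show ?thesis by (rule power2_eq_imp_eq) auto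
qed

text \<open>A geometric sum with ratio \<open>z\<close>: the numerator has modulus at most 2, and
  \<open>1 - z\<close> has modulus at least \<open>4 * \<bar>\<theta>\<bar>\<close>.\<close>

lemma norm_sum_cis_le:
  assumes "0 < \<bar>\<theta>\<bar>" "\<bar>\<theta>\<bar> \<le> 1/2"
  shows "cmod (\<Sum>n=a..b. cis (2 * pi * real n * \<theta>)) \<le> 1 / (2 * \<bar>\<theta>\<bar>)"
proof (cases "a \<le> b")
  case True
  define z where "z = cis (2 * (pi * \<theta>))"
  have "2 * \<bar>\<theta>\<bar> \<le> sin (pi * \<bar>\<theta>\<bar>)" using assms by (intro sin_pi_mult_ge) auto
  hence "2 * \<bar>\<theta>\<bar> \<le> \<bar>sin (pi * \<theta>)\<bar>" by (cases "\<theta> \<ge> 0") auto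
  hence z: "4 * \<bar>\<theta>\<bar> \<le> cmod (1 - z)" by (simp add: z_def norm_one_minus_cis)
  have "(1 - z) * (\<Sum>n=a..b. z ^ n) = z ^ a - z ^ Suc b" by (rule sum_gp_multiplied[OF True])
  hence "cmod (1 - z) * cmod (\<Sum>n=a..b. z ^ n) = cmod (z ^ a - z ^ Suc b)"
    by (metis norm_mult)
  also have "\<dots> \<le> cmod (z ^ a) + cmod (z ^ Suc b)" by (rule norm_triangle_ineq4)
  also have "\<dots> = 2" by (simp add: norm_power z_def norm_mult)
  finally have "cmod (1 - z) * cmod (\<Sum>n=a..b. z ^ n) \<le> 2" .
  moreover have "4 * \<bar>\<theta>\<bar> * cmod (\<Sum>n=a..b. z ^ n) \<le> cmod (1 - z) * cmod (\<Sum>n=a..b. z ^ n)"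
    using z by (rule mult_right_mono) simp
  ultimately have "4 * \<bar>\<theta>\<bar> * cmod (\<Sum>n=a..b. z ^ n) \<le> 2" by linarith
  moreover have "z ^ n = cis (2 * pi * real n * \<theta>)" for n
    by (simp only: z_def Complex.DeMoivre mult_ac)
  ultimately show ?thesis using assms by (simp add: field_simps)
qed (use assms in auto)

text \<open>Summation by parts: the coefficients \<open>w b\<close> and
  \<open>w n - w (Suc n)\<close> of the partial sums are nonnegative and add up to
  \<open>w a\<close>.\<close>

lemma norm_sum_decreasing_weights_le:
  fixes z :: "nat \<Rightarrow> 'a::real_normed_vector" and w :: "nat \<Rightarrow> real"
  assumes w: "\<And>n. n \<ge> a \<Longrightarrow> 0 \<le> w n" "\<And>n. n \<ge> a \<Longrightarrow> w (Suc n) \<le> w n"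
    and B: "\<And>b. norm (\<Sum>n=a..b. z n) \<le> B"
  shows "norm (\<Sum>n=a..b. w n *\<^sub>R z n) \<le> w a * B"
proof (cases "a \<le> b")
  case True
  have "(\<Sum>n=a..b. w n *\<^sub>R z n) =
      w b *\<^sub>R (\<Sum>n=a..b. z n) + (\<Sum>n=a..<b. (w n - w (Suc n)) *\<^sub>R (\<Sum>k=a..n. z k))"
    using True by (induction b rule: dec_induct) (simp_all add: algebra_simps)
  also have "norm \<dots> \<le> norm (w b *\<^sub>R (\<Sum>n=a..b. z n)) +
      (\<Sum>n=a..<b. norm ((w n - w (Suc n)) *\<^sub>R (\<Sum>k=a..n. z k)))"
    by (rule order_trans[OF norm_triangle_ineq], rule add_left_mono, rule norm_sum)
  also have "\<dots> \<le> w b * B + (\<Sum>n=a..<b. (w n - w (Suc n)) * B)"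
    using w True B by (intro add_mono sum_mono) (auto intro!: mult_left_mono)
  also have "(\<Sum>n=a..<b. (w n - w (Suc n)) * B) = (w a - w b) * B"
    unfolding sum_distrib_right[symmetric] using sum_Suc_diff'[of a b "\<lambda>n. - w n"] True by simp
  finally show ?thesis by (simp add: algebra_simps)
next
  case False
  have "0 \<le> B" using B[of 0] norm_ge_zero order_trans by blast
  thus ?thesis using False w(1)[of a] by simp
qed

lemma norm_sum_cis_over_n_le:
  assumes "0 < \<bar>\<theta>\<bar>" "\<bar>\<theta>\<bar> \<le> 1/2" "a > 0"
  shows "cmod (\<Sum>n=a..b. (1 / real n) *\<^sub>R cis (2 * pi * real n * \<theta>)) \<le> 1 / (2 * real a * \<bar>\<theta>\<bar>)"
proof -
  have "cmod (\<Sum>n=a..b. (1 / real n) *\<^sub>R cis (2 * pi * real n * \<theta>)) \<le> 1 / real a * (1 / (2 * \<bar>\<theta>\<bar>))"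
    using assms by (intro norm_sum_decreasing_weights_le norm_sum_cis_le) (auto simp: field_simps)
  thus ?thesis using assms by (simp add: field_simps)
qed

text \<open>Open the square and sum over \<open>n\<close> first. The diagonal gives the harmonic
  term; off the diagonal the decreasing weights \<open>1 / n\<close> on a geometric sum save the
  factor \<open>1 / a\<close>. Differences of at most \<open>1/2\<close> equal their distance to the
  nearest integer.\<close>

lemma sum_norm_exp_sum_sq_le:
  fixes x :: "'a \<Rightarrow> real"
  assumes "finite S" "a > 0"
    and x: "\<And>r s. r \<in> S \<Longrightarrow> s \<in> S \<Longrightarrow> r \<noteq> s \<Longrightarrow> 0 < \<bar>x r - x s\<bar> \<and> \<bar>x r - x s\<bar> \<le> 1/2"
  shows "(\<Sum>n=a..b. (cmod (\<Sum>r\<in>S. cis (2 * pi * real n * x r)))\<^sup>2 / real n) \<le>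
     real (card S) * (\<Sum>n=a..b. 1 / real n) +
     1 / (2 * real a) * (\<Sum>r\<in>S. \<Sum>s\<in>S - {r}. 1 / \<bar>x r - x s\<bar>)"
proof -
  let ?E = "\<lambda>n. \<Sum>r\<in>S. cis (2 * pi * real n * x r)"
  let ?G = "\<lambda>r s. \<Sum>n=a..b. (1 / real n) *\<^sub>R cis (2 * pi * real n * (x r - x s))"
  have E: "complex_of_real ((cmod (?E n))\<^sup>2 / real n) =
      (\<Sum>r\<in>S. \<Sum>s\<in>S. (1 / real n) *\<^sub>R cis (2 * pi * real n * (x r - x s)))" for n
  proof -
    have "complex_of_real ((cmod (?E n))\<^sup>2) = ?E n * cnj (?E n)" by (rule complex_norm_square)
    also have "\<dots> = (\<Sum>r\<in>S. \<Sum>s\<in>S. cis (2 * pi * real n * (x r - x s)))"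
      by (simp add: sum_product cis_cnj cis_mult algebra_simps)
    finally have "(1 / real n) *\<^sub>R complex_of_real ((cmod (?E n))\<^sup>2) =
        (\<Sum>r\<in>S. \<Sum>s\<in>S. (1 / real n) *\<^sub>R cis (2 * pi * real n * (x r - x s)))"
      by (simp only: scaleR_sum_right)
    thus ?thesis by (simp add: scaleR_conv_of_real)
  qed
  have "(\<Sum>n=a..b. (cmod (?E n))\<^sup>2 / real n) \<le>
      cmod (complex_of_real (\<Sum>n=a..b. (cmod (?E n))\<^sup>2 / real n))"
    by (simp only: norm_of_real abs_ge_self)
  also have "complex_of_real (\<Sum>n=a..b. (cmod (?E n))\<^sup>2 / real n) =
      (\<Sum>n=a..b. \<Sum>r\<in>S. \<Sum>s\<in>S. (1 / real n) *\<^sub>R cis (2 * pi * real n * (x r - x s)))"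
    by (simp only: of_real_sum E)
  also have "\<dots> = (\<Sum>r\<in>S. \<Sum>n=a..b. \<Sum>s\<in>S. (1 / real n) *\<^sub>R cis (2 * pi * real n * (x r - x s)))"
    by (rule sum.swap)
  also have "\<dots> = (\<Sum>r\<in>S. \<Sum>s\<in>S. ?G r s)" by (rule sum.cong[OF refl]) (rule sum.swap)
  also have "cmod \<dots> \<le> (\<Sum>r\<in>S. \<Sum>s\<in>S. cmod (?G r s))"
    by (rule order_trans[OF norm_sum], rule sum_mono, rule norm_sum)
  also have "\<dots> = (\<Sum>r\<in>S. cmod (?G r r) + (\<Sum>s\<in>S - {r}. cmod (?G r s)))"
    using assms(1) by (intro sum.cong refl) (rule sum.remove)
  also have "\<dots> \<le> (\<Sum>r\<in>S. (\<Sum>n=a..b. 1 / real n) + (\<Sum>s\<in>S - {r}. 1 / (2 * real a) * (1 / \<bar>x r - x s\<bar>)))"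
  proof (intro sum_mono add_mono)
    fix r s assume "r \<in> S" "s \<in> S - {r}"
    hence "cmod (?G r s) \<le> 1 / (2 * real a * \<bar>x r - x s\<bar>)"
      using x[of r s] assms(2) by (intro norm_sum_cis_over_n_le) auto
    thus "cmod (?G r s) \<le> 1 / (2 * real a) * (1 / \<bar>x r - x s\<bar>)" by simp
  next
    fix r
    have "cmod (?G r r) \<le> (\<Sum>n=a..b. cmod ((1 / real n) *\<^sub>R cis (2 * pi * real n * (x r - x r))))"
      by (rule norm_sum)
    thus "cmod (?G r r) \<le> (\<Sum>n=a..b. 1 / real n)" by simp
  qed
  also have "\<dots> = real (card S) * (\<Sum>n=a..b. 1 / real n) +
     1 / (2 * real a) * (\<Sum>r\<in>S. \<Sum>s\<in>S - {r}. 1 / \<bar>x r - x s\<bar>)"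
    by (simp only: sum.distrib sum_constant sum_distrib_left)
  finally show ?thesis .
qed

section \<open>Spaced points and the spacing of Farey fractions\<close>

text \<open>The spacing makes the integers \<open>\<lfloor>M * y\<rfloor>\<close> distinct members
  of \<open>{1..M}\<close>, and \<open>1 / y\<close> is at most \<open>M\<close> divided by this
  integer.\<close>

lemma sum_inverse_spaced_le:
  fixes U :: "real set" and M :: nat
  assumes "finite U" "M > 0" "\<And>y. y \<in> U \<Longrightarrow> 1 / real M \<le> y \<and> y \<le> 1"
    and sp: "\<And>y z. y \<in> U \<Longrightarrow> z \<in> U \<Longrightarrow> y \<noteq> z \<Longrightarrow> 1 / real M \<le> \<bar>y - z\<bar>"
  shows "(\<Sum>y\<in>U. 1 / y) \<le> real M * harm M"
proof -
  define k where "k y = nat \<lfloor>real M * y\<rfloor>" for y :: real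
  have y: "1 \<le> real M * y" "real M * y \<le> real M" if "y \<in> U" for y
    using assms(2) assms(3)[OF that] by (simp_all add: field_simps)
  have inj: "inj_on k U"
  proof (rule inj_onI, rule ccontr)
    fix u v assume *: "u \<in> U" "v \<in> U" "k u = k v" "u \<noteq> v"
    have "int (k w) = \<lfloor>real M * w\<rfloor>" if "w \<in> U" for w using y(1)[OF that] by (simp add: k_def)
    hence "\<lfloor>real M * u\<rfloor> = \<lfloor>real M * v\<rfloor>" using *(1-3) by metis
    hence "\<bar>real M * u - real M * v\<bar> < 1" by linarith
    moreover have "\<bar>real M * u - real M * v\<bar> = real M * \<bar>u - v\<bar>"
      by (simp add: abs_mult flip: right_diff_distrib)
    ultimately show False using sp[OF *(1,2,4)] assms(2) by (simp add: field_simps)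
  qed
  have "(\<Sum>y\<in>U. 1 / y) \<le> (\<Sum>y\<in>U. real M * (1 / real (k y)))"
  proof (rule sum_mono)
    fix u assume u: "u \<in> U"
    have "real (k u) \<le> real M * u" "1 \<le> k u" using y[OF u] by (simp_all add: k_def le_nat_floor)
    moreover have "u > 0" using assms(2) assms(3)[OF u] by (meson divide_pos_pos less_le_trans of_nat_0_less_iff zero_less_one)
    ultimately show "1 / u \<le> real M * (1 / real (k u))" by (simp add: field_simps)
  qed
  also have "\<dots> = real M * (\<Sum>j\<in>k ` U. 1 / real j)"
    using inj by (simp add: sum.reindex sum_distrib_left)
  also have "(\<Sum>j\<in>k ` U. 1 / real j) \<le> (\<Sum>j=1..M. 1 / real j)"
  proof (rule sum_mono2)
    show "k ` U \<subseteq> {1..M}"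
    proof (intro subsetI, elim imageE)
      fix j u assume u: "j = k u" "u \<in> U"
      have "\<lfloor>real M * u\<rfloor> \<le> int M" using y(2)[OF u(2)] by linarith
      moreover have "1 \<le> \<lfloor>real M * u\<rfloor>" using y(1)[OF u(2)] by (simp only: one_le_floor)
      ultimately show "j \<in> {1..M}" unfolding u(1) k_def atLeastAtMost_iff
        using nat_mono[of 1 "\<lfloor>real M * u\<rfloor>"] by (simp only: nat_le_iff nat_one_as_int[symmetric] nat_1 One_nat_def)
    qed
  qed auto
  also have "(\<Sum>j=1..M. 1 / real j) = harm M" by (simp add: harm_def inverse_eq_divide)
  finally show ?thesis by (simp add: mult_left_mono)
qed

text \<open>The distances to points right of \<open>x\<close>, and likewise to those left of
  \<open>x\<close>, are again spaced, whence the factor 2.\<close>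

lemma sum_inverse_dist_le:
  fixes U :: "real set" and M :: nat
  assumes "finite U" "M > 0" "U \<subseteq> {0..1}" "x \<in> U"
    and sp: "\<And>y z. y \<in> U \<Longrightarrow> z \<in> U \<Longrightarrow> y \<noteq> z \<Longrightarrow> 1 / real M \<le> \<bar>y - z\<bar>"
  shows "(\<Sum>y\<in>U - {x}. 1 / \<bar>x - y\<bar>) \<le> 2 * real M * harm M"
proof -
  define A where "A = {y\<in>U. x < y}"
  define B where "B = {y\<in>U. y < x}"
  have fin: "finite A" "finite B" using assms(1) by (auto simp: A_def B_def)
  have x: "0 \<le> x" "x \<le> 1" using assms by auto
  have U: "U - {x} = A \<union> B" using assms by (auto simp: A_def B_def)
  have "(\<Sum>y\<in>U - {x}. 1 / \<bar>x - y\<bar>) = (\<Sum>y\<in>A. 1 / \<bar>x - y\<bar>) + (\<Sum>y\<in>B. 1 / \<bar>x - y\<bar>)"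
    unfolding U using fin by (rule sum.union_disjoint) (auto simp: A_def B_def)
  also have "(\<Sum>y\<in>A. 1 / \<bar>x - y\<bar>) = (\<Sum>u\<in>(\<lambda>y. y - x) ` A. 1 / u)"
    by (subst sum.reindex) (auto simp: inj_on_def A_def intro!: sum.cong)
  also have "\<dots> \<le> real M * harm M"
  proof (rule sum_inverse_spaced_le)
    fix u assume "u \<in> (\<lambda>y. y - x) ` A"
    then obtain y where y: "u = y - x" "y \<in> U" "x < y" by (auto simp: A_def)
    thus "1 / real M \<le> u \<and> u \<le> 1" using sp[of y x] assms(3,4) x by auto
  next
    fix u v assume "u \<in> (\<lambda>y. y - x) ` A" "v \<in> (\<lambda>y. y - x) ` A" "u \<noteq> v"
    thus "1 / real M \<le> \<bar>u - v\<bar>" using sp by (auto simp: A_def)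
  qed (use fin assms in auto)
  also have "(\<Sum>y\<in>B. 1 / \<bar>x - y\<bar>) = (\<Sum>u\<in>(\<lambda>y. x - y) ` B. 1 / u)"
    by (subst sum.reindex) (auto simp: inj_on_def B_def intro!: sum.cong)
  also have "\<dots> \<le> real M * harm M"
  proof (rule sum_inverse_spaced_le)
    fix u assume "u \<in> (\<lambda>y. x - y) ` B"
    then obtain y where y: "u = x - y" "y \<in> U" "y < x" by (auto simp: B_def)
    thus "1 / real M \<le> u \<and> u \<le> 1" using sp[of x y] assms(3,4) x by auto
  next
    fix u v assume uv: "u \<in> (\<lambda>y. x - y) ` B" "v \<in> (\<lambda>y. x - y) ` B" "u \<noteq> v"
    then obtain y z where "u = x - y" "v = x - z" "y \<in> U" "z \<in> U" "y \<noteq> z" by (auto simp: B_def)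
    thus "1 / real M \<le> \<bar>u - v\<bar>" using sp[of z y] by auto
  qed (use fin assms in auto)
  finally show ?thesis by (simp add: algebra_simps)
qed

text \<open>The difference is a nonzero integer over a product of two denominators, each at most
  \<open>T\<close>.\<close>

lemma farey_spacing:
  assumes "\<xi> \<in> farey T" "\<eta> \<in> farey T" "\<xi> \<noteq> \<eta>"
  shows "1 / real (T\<^sup>2) \<le> \<bar>\<xi> - \<eta>\<bar>"
proof -
  obtain a b where ab: "\<xi> = real a / real b" "a < b" "b \<le> T" using assms(1) by (auto simp: mem_farey_iff)
  obtain c d where cd: "\<eta> = real c / real d" "c < d" "d \<le> T" using assms(2) by (auto simp: mem_farey_iff)
  have pos: "real b > 0" "real d > 0" using ab cd by auto
  have eq: "\<xi> - \<eta> = real_of_int (int a * int d - int c * int b) / (real b * real d)"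
    unfolding ab(1) cd(1) using pos by (simp add: field_simps)
  have "int a * int d - int c * int b \<noteq> 0"
  proof
    assume "int a * int d - int c * int b = 0"
    hence "\<xi> - \<eta> = 0" unfolding eq by (simp only: of_int_0 div_0)
    thus False using assms(3) by simp
  qed
  hence "1 \<le> \<bar>int a * int d - int c * int b\<bar>" by linarith
  hence "1 \<le> \<bar>real_of_int (int a * int d - int c * int b)\<bar>" by linarith
  hence "1 / (real b * real d) \<le> \<bar>real_of_int (int a * int d - int c * int b)\<bar> / (real b * real d)"
    by (rule divide_right_mono) (use pos in simp)
  hence "1 / (real b * real d) \<le> \<bar>\<xi> - \<eta>\<bar>"
    unfolding eq abs_divide using pos by (simp only: abs_of_pos mult_pos_pos)
  moreover have "real b * real d \<le> real T * real T"
    using ab cd by (intro mult_mono) auto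
  hence "real b * real d \<le> real (T\<^sup>2)" by (simp add: power2_eq_square)
  hence "1 / real (T\<^sup>2) \<le> 1 / (real b * real d)" using pos by (intro frac_le) auto
  ultimately show ?thesis by linarith
qed

text \<open>The sequence \<open>harm n - ln n\<close> decreases from its value 1 at
  \<open>n = 1\<close>; the library sequence is indexed from 0, hence \<open>n - 1\<close>.\<close>

lemma harm_le_ln: "n > 0 \<Longrightarrow> harm n \<le> 1 + ln (real n)"
  using decseq_harm_diff_ln unfolding decseq_def
  by (drule_tac spec[of _ 0]) (drule_tac spec[of _ "n - 1"], simp add: harm_def)

text \<open>Zero is left out because the estimates divide by \<open>\<xi>\<close>; its term in a sum
  of \<open>frac (m * \<xi>\<^sup>2)\<close> vanishes.\<close>

definition farey_half :: "nat \<Rightarrow> real set" where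
  "farey_half T = {\<xi> \<in> farey T. 0 < \<xi> \<and> \<xi> \<le> 1/2}"

lemma farey_half_subset: "farey_half T \<subseteq> farey T"
  by (auto simp: farey_half_def)

lemma finite_farey_half: "finite (farey_half T)"
  using finite_farey by (rule finite_subset[OF farey_half_subset])

lemma zero_in_farey: "T > 0 \<Longrightarrow> 0 \<in> farey T"
  unfolding mem_farey_iff by (intro exI[of _ 0] exI[of _ 1]) auto

lemma sum_inverse_dist_farey_le:
  assumes "T > 0" "\<xi> \<in> farey T"
  shows "(\<Sum>\<eta>\<in>farey T - {\<xi>}. 1 / \<bar>\<xi> - \<eta>\<bar>) \<le> 4 * (real T)\<^sup>2 * (1 + ln (real T))"
proof -
  have "(\<Sum>\<eta>\<in>farey T - {\<xi>}. 1 / \<bar>\<xi> - \<eta>\<bar>) \<le> 2 * real (T\<^sup>2) * harm (T\<^sup>2)"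
  proof (rule sum_inverse_dist_le)
    show "farey T \<subseteq> {0..1}" using farey_bounds by force
  qed (use assms finite_farey farey_spacing in auto)
  also have "2 * real (T\<^sup>2) * harm (T\<^sup>2) \<le> 2 * real (T\<^sup>2) * (2 * (1 + ln (real T)))"
  proof (rule mult_left_mono)
    have "harm (T\<^sup>2) \<le> 1 + ln (real (T\<^sup>2))" using assms by (intro harm_le_ln) simp
    thus "harm (T\<^sup>2) \<le> 2 * (1 + ln (real T))" using assms by (simp add: ln_realpow)
  qed simp
  finally show ?thesis by (simp add: algebra_simps)
qed

lemma card_farey_half_le:
  assumes "T > 0"
  shows "real (card (farey_half T)) \<le> (real T)\<^sup>2"
proof -
  have "farey T \<subseteq> (\<lambda>(a, b). real a / real b) ` ({..<T} \<times> {1..T})"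
    by (force simp: mem_farey_iff)
  hence "card (farey T) \<le> card ({..<T} \<times> {1..T})"
    by (intro surj_card_le) auto
  moreover have "card (farey_half T) \<le> card (farey T)"
    using finite_farey farey_half_subset by (rule card_mono)
  ultimately have "card (farey_half T) \<le> T\<^sup>2" by (simp add: power2_eq_square)
  hence "real (card (farey_half T)) \<le> real (T\<^sup>2)" by (simp only: of_nat_le_iff)
  thus ?thesis by simp
qed

text \<open>Near \<open>0\<close> the squares of Farey fractions are closer together than \<open>T\<^sup>-\<^sup>2\<close>; the factor
  \<open>\<xi> + \<eta> \<ge> \<xi>\<close> of \<open>\<xi>\<^sup>2 - \<eta>\<^sup>2\<close> accounts for this, since the inverses of the \<open>\<xi>\<close>
  are themselves summable with the same bound.\<close>

lemma sum_inverse_dist_squares_farey_le: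
  assumes "T > 0"
  shows "(\<Sum>\<xi>\<in>farey_half T. \<Sum>\<eta>\<in>farey_half T - {\<xi>}. 1 / \<bar>\<xi>\<^sup>2 - \<eta>\<^sup>2\<bar>) \<le>
     16 * (real T) ^ 4 * (1 + ln (real T))\<^sup>2"
proof -
  let ?L = "4 * (real T)\<^sup>2 * (1 + ln (real T))"
  have L: "0 \<le> ?L" using assms by simp
  have "(\<Sum>\<xi>\<in>farey_half T. \<Sum>\<eta>\<in>farey_half T - {\<xi>}. 1 / \<bar>\<xi>\<^sup>2 - \<eta>\<^sup>2\<bar>) \<le>
      (\<Sum>\<xi>\<in>farey_half T. 1 / \<xi> * ?L)"
  proof (rule sum_mono)
    fix \<xi> assume \<xi>: "\<xi> \<in> farey_half T"
    hence \<xi>0: "\<xi> > 0" "\<xi> \<in> farey T" by (auto simp: farey_half_def)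
    have "(\<Sum>\<eta>\<in>farey_half T - {\<xi>}. 1 / \<bar>\<xi>\<^sup>2 - \<eta>\<^sup>2\<bar>) \<le> (\<Sum>\<eta>\<in>farey_half T - {\<xi>}. 1 / \<xi> * (1 / \<bar>\<xi> - \<eta>\<bar>))"
    proof (rule sum_mono)
      fix \<eta> assume \<eta>: "\<eta> \<in> farey_half T - {\<xi>}"
      hence "\<eta> > 0" "\<bar>\<xi> - \<eta>\<bar> > 0" by (auto simp: farey_half_def)
      have "\<bar>\<xi>\<^sup>2 - \<eta>\<^sup>2\<bar> = (\<xi> + \<eta>) * \<bar>\<xi> - \<eta>\<bar>"
        using \<open>\<eta> > 0\<close> \<xi>0 by (simp add: power2_eq_square square_diff_square_factored abs_mult)
      also have "\<dots> \<ge> \<xi> * \<bar>\<xi> - \<eta>\<bar>" using \<open>\<eta> > 0\<close> by (intro mult_right_mono) auto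
      finally have "1 / \<bar>\<xi>\<^sup>2 - \<eta>\<^sup>2\<bar> \<le> 1 / (\<xi> * \<bar>\<xi> - \<eta>\<bar>)"
        using mult_pos_pos[OF \<xi>0(1) \<open>\<bar>\<xi> - \<eta>\<bar> > 0\<close>] by (intro frac_le) auto
      thus "1 / \<bar>\<xi>\<^sup>2 - \<eta>\<^sup>2\<bar> \<le> 1 / \<xi> * (1 / \<bar>\<xi> - \<eta>\<bar>)" by simp
    qed
    also have "\<dots> = 1 / \<xi> * (\<Sum>\<eta>\<in>farey_half T - {\<xi>}. 1 / \<bar>\<xi> - \<eta>\<bar>)"
      by (simp only: sum_distrib_left)
    also have "(\<Sum>\<eta>\<in>farey_half T - {\<xi>}. 1 / \<bar>\<xi> - \<eta>\<bar>) \<le> (\<Sum>\<eta>\<in>farey T - {\<xi>}. 1 / \<bar>\<xi> - \<eta>\<bar>)"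
      using finite_farey farey_half_subset by (intro sum_mono2) auto
    also have "\<dots> \<le> ?L" by (rule sum_inverse_dist_farey_le) fact+
    finally show "(\<Sum>\<eta>\<in>farey_half T - {\<xi>}. 1 / \<bar>\<xi>\<^sup>2 - \<eta>\<^sup>2\<bar>) \<le> 1 / \<xi> * ?L"
      using \<xi>0 by (simp add: mult_left_mono divide_right_mono)
  qed
  \<comment> \<open>The inverses of the \<open>\<xi>\<close> are inverse distances to the Farey
    fraction 0, so the estimate of the inner sum applies once more.\<close>
  also have "\<dots> = (\<Sum>\<xi>\<in>farey_half T. 1 / \<bar>0 - \<xi>\<bar>) * ?L"
    unfolding sum_distrib_right by (intro sum.cong refl) (auto simp: farey_half_def)
  also have "(\<Sum>\<xi>\<in>farey_half T. 1 / \<bar>0 - \<xi>\<bar>) \<le> (\<Sum>\<xi>\<in>farey T - {0}. 1 / \<bar>0 - \<xi>\<bar>)"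
    using finite_farey by (intro sum_mono2) (auto simp: farey_half_def)
  also have "\<dots> \<le> ?L" using assms zero_in_farey by (intro sum_inverse_dist_farey_le) auto
  finally have "(\<Sum>\<xi>\<in>farey_half T. \<Sum>\<eta>\<in>farey_half T - {\<xi>}. 1 / \<bar>\<xi>\<^sup>2 - \<eta>\<^sup>2\<bar>) \<le> ?L * ?L"
    using L by (simp add: mult_right_mono)
  also have "?L * ?L = 16 * (real T) ^ 4 * (1 + ln (real T))\<^sup>2"
    by (simp add: power2_eq_square power4_eq_xxxx)
  finally show ?thesis .
qed

section \<open>Moments of the exponential sums over squares of Farey fractions\<close>

abbreviation exp_sum :: "nat \<Rightarrow> nat \<Rightarrow> complex" where
  "exp_sum T n \<equiv> \<Sum>\<xi>\<in>farey_half T. cis (2 * pi * real n * \<xi>\<^sup>2)"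

lemma sum_inverse_le_ln:
  assumes "T > 0"
  shows "(\<Sum>m\<in>{a<..T}. 1 / real m) \<le> 1 + ln (real T)"
proof -
  have "(\<Sum>m\<in>{a<..T}. 1 / real m) \<le> (\<Sum>m=1..T. 1 / real m)" by (rule sum_mono2) auto
  also have "\<dots> = harm T" by (simp add: harm_def inverse_eq_divide)
  also have "\<dots> \<le> 1 + ln (real T)" using assms by (rule harm_le_ln)
  finally show ?thesis .
qed

text \<open>For fixed \<open>h\<close> the products \<open>n = h * m\<close> are distinct. All
  summands are nonnegative, so the sum may be enlarged to a full interval of \<open>n\<close>, where
  the mean square bound applies.\<close>

lemma sum_norm_exp_sum_dilated_sq_le:
  assumes "T > 0" "h \<ge> 1" "h \<le> T"
  shows "(\<Sum>m\<in>{nat \<lfloor>sqrt T\<rfloor><..T}. (cmod (exp_sum T (h * m)))\<^sup>2 / (real h * real m)) \<le>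
     2 * (real T)\<^sup>2 * (1 + ln (real T)) + 8 * (real T) powr (7/2) * (1 + ln (real T))\<^sup>2 / real h"
proof -
  \<comment> \<open>The least product that occurs. Since \<open>a \<ge> h * sqrt T\<close>, the
    off-diagonal part gains both \<open>1 / sqrt T\<close> and \<open>1 / h\<close>.\<close>
  define a where "a = h * (nat \<lfloor>sqrt T\<rfloor> + 1)"
  let ?L = "1 + ln (real T)"
  have L: "?L \<ge> 1" using assms by simp
  have "real h * sqrt T \<le> real h * real (nat \<lfloor>sqrt T\<rfloor> + 1)"
    by (intro mult_left_mono) linarith+
  hence a: "real h * sqrt T \<le> real a" by (simp only: a_def of_nat_mult)
  have apos: "0 < real h * sqrt T" using assms by simp
  have a0: "a > 0" using assms by (simp add: a_def)
  have "(\<Sum>m\<in>{nat \<lfloor>sqrt T\<rfloor><..T}. (cmod (exp_sum T (h * m)))\<^sup>2 / (real h * real m)) =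
      (\<Sum>n\<in>(\<lambda>m. h * m) ` {nat \<lfloor>sqrt T\<rfloor><..T}. (cmod (exp_sum T n))\<^sup>2 / real n)"
    using assms by (subst sum.reindex) (auto simp: inj_on_def)
  also have "\<dots> \<le> (\<Sum>n=a..h * T. (cmod (exp_sum T n))\<^sup>2 / real n)"
  proof (rule sum_mono2)
    show "(\<lambda>m. h * m) ` {nat \<lfloor>sqrt T\<rfloor><..T} \<subseteq> {a..h * T}"
      unfolding a_def
      by (intro image_subsetI) (simp only: atLeastAtMost_iff greaterThanAtMost_iff, intro conjI mult_le_mono, auto)
  qed auto
  also have "\<dots> \<le> real (card (farey_half T)) * (\<Sum>n=a..h * T. 1 / real n) +
     1 / (2 * real a) * (\<Sum>\<xi>\<in>farey_half T. \<Sum>\<eta>\<in>farey_half T - {\<xi>}. 1 / \<bar>\<xi>\<^sup>2 - \<eta>\<^sup>2\<bar>)"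
  proof (rule sum_norm_exp_sum_sq_le[OF finite_farey_half a0])
    fix \<xi> \<eta> assume *: "\<xi> \<in> farey_half T" "\<eta> \<in> farey_half T" "\<xi> \<noteq> \<eta>"
    have "\<xi>\<^sup>2 \<noteq> \<eta>\<^sup>2" using * by (auto simp: farey_half_def power2_eq_iff)
    moreover have "0 \<le> \<zeta>\<^sup>2 \<and> \<zeta>\<^sup>2 \<le> 1/2" if "\<zeta> \<in> farey_half T" for \<zeta>
    proof -
      have "0 \<le> \<zeta>" "\<zeta> \<le> 1/2" using that by (auto simp: farey_half_def)
      hence "\<zeta>\<^sup>2 \<le> (1/2)\<^sup>2" by (intro power_mono)
      thus ?thesis by (simp add: power2_eq_square)
    qed
    from this[OF *(1)] this[OF *(2)] have "\<bar>\<xi>\<^sup>2 - \<eta>\<^sup>2\<bar> \<le> 1/2" by linarith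
    ultimately show "0 < \<bar>\<xi>\<^sup>2 - \<eta>\<^sup>2\<bar> \<and> \<bar>\<xi>\<^sup>2 - \<eta>\<^sup>2\<bar> \<le> 1/2" by simp
  qed
  also have "\<dots> \<le> (real T)\<^sup>2 * (2 * ?L) + 1 / (2 * (real h * sqrt T)) * (16 * (real T) ^ 4 * ?L\<^sup>2)"
  proof (intro add_mono mult_mono)
    have "(\<Sum>n=a..h * T. 1 / real n) \<le> (\<Sum>n\<in>{0<..h * T}. 1 / real n)"
      using a0 by (intro sum_mono2) auto
    also have "\<dots> \<le> 1 + ln (real (h * T))" using assms by (intro sum_inverse_le_ln) auto
    also have "ln (real (h * T)) = ln (real h) + ln (real T)" using assms by (simp add: ln_mult)
    also have "ln (real h) \<le> ln (real T)" using assms by simp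
    finally show "(\<Sum>n=a..h * T. 1 / real n) \<le> 2 * ?L" by simp
    show "1 / (2 * real a) \<le> 1 / (2 * (real h * sqrt T))"
      using a apos by (intro divide_left_mono) auto
  qed (use assms card_farey_half_le sum_inverse_dist_squares_farey_le in \<open>auto intro!: sum_nonneg\<close>)
  also have "1 / (2 * (real h * sqrt T)) * (16 * (real T) ^ 4 * ?L\<^sup>2) = 8 * (real T ^ 4 / sqrt T) * ?L\<^sup>2 / real h"
    using assms by (simp add: field_simps)
  also have "real T ^ 4 / sqrt T = real T powr (7/2)"
  proof -
    have "real T ^ 4 = real T powr 4" using assms by simp
    moreover have "sqrt T = real T powr (1/2)" using assms by (simp add: powr_half_sqrt)
    ultimately have "real T ^ 4 / sqrt T = real T powr (4 - 1/2)" by (simp only: powr_diff)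
    thus ?thesis by simp
  qed
  also have "(real T)\<^sup>2 * (2 * ?L) = 2 * (real T)\<^sup>2 * ?L" by simp
  finally show ?thesis by (simp only: mult.assoc)
qed

text \<open>Cauchy-Schwarz with the weights \<open>1 / (h * m)\<close>, whose total is at most the
  square of \<open>1 + ln T\<close>.\<close>

lemma sum_norm_exp_sum_le:
  assumes "T > 0"
  shows "(\<Sum>h=1..<T. \<Sum>m\<in>{nat \<lfloor>sqrt T\<rfloor><..T}. cmod (exp_sum T (h * m)) / (real h * real m)) \<le>
     4 * (real T) powr (7/4) * (1 + ln (real T)) ^ 3"
proof -
  let ?L = "1 + ln (real T)"
  let ?P = "{1..<T} \<times> {nat \<lfloor>sqrt T\<rfloor><..T}"
  have L: "?L \<ge> 1" using assms by simp
  define X where "X = (\<Sum>(h,m)\<in>?P. cmod (exp_sum T (h * m)) / (real h * real m))"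
  have h1: "(\<Sum>h=1..<T. 1 / real h) \<le> ?L"
  proof -
    have "(\<Sum>h=1..<T. 1 / real h) \<le> (\<Sum>h\<in>{0<..T}. 1 / real h)" by (rule sum_mono2) auto
    also have "\<dots> \<le> ?L" using assms by (rule sum_inverse_le_ln)
    finally show ?thesis .
  qed
  have Z: "(\<Sum>(h,m)\<in>?P. (cmod (exp_sum T (h * m)))\<^sup>2 / (real h * real m)) \<le> 10 * real T powr (7/2) * ?L ^ 3"
  proof -
    have "(\<Sum>(h,m)\<in>?P. (cmod (exp_sum T (h * m)))\<^sup>2 / (real h * real m)) =
        (\<Sum>h=1..<T. \<Sum>m\<in>{nat \<lfloor>sqrt T\<rfloor><..T}. (cmod (exp_sum T (h * m)))\<^sup>2 / (real h * real m))"
      by (rule sum.cartesian_product[symmetric])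
    \<comment> \<open>The diagonal term does not decay in \<open>h\<close> and adds up to about the
      cube of \<open>T\<close>, still below \<open>T powr (7/2)\<close>. The other term costs one
      more logarithm.\<close>
    also have "\<dots> \<le> (\<Sum>h=1..<T. 2 * (real T)\<^sup>2 * ?L + 8 * (real T) powr (7/2) * ?L\<^sup>2 * (1 / real h))"
      by (intro sum_mono order_trans[OF sum_norm_exp_sum_dilated_sq_le]) (use assms in auto)
    also have "\<dots> = 2 * (real (T - 1) * (real T)\<^sup>2) * ?L + 8 * (real T) powr (7/2) * ?L\<^sup>2 * (\<Sum>h=1..<T. 1 / real h)"
      by (simp only: sum.distrib sum_constant sum_distrib_left) simp
    also have "\<dots> \<le> 2 * real T powr (7/2) * ?L ^ 3 + 8 * (real T) powr (7/2) * ?L\<^sup>2 * ?L"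
    proof (intro add_mono mult_mono mult_left_mono)
      have "real (T - 1) * (real T)\<^sup>2 \<le> real T * (real T)\<^sup>2" by (intro mult_right_mono) auto
      also have "\<dots> = real T powr 3" using assms by (simp add: power2_eq_square power3_eq_cube)
      also have "\<dots> \<le> real T powr (7/2)" using assms by (intro powr_mono) auto
      finally show "real (T - 1) * (real T)\<^sup>2 \<le> real T powr (7/2)" .
      show "?L \<le> ?L ^ 3" using L by (simp add: self_le_power)
    qed (use L h1 in \<open>auto intro!: sum_nonneg\<close>)
    also have "\<dots> = 10 * real T powr (7/2) * ?L ^ 3" by (simp add: power2_eq_square power3_eq_cube)
    finally show ?thesis .
  qed
  have W: "(\<Sum>(h,m)\<in>?P. 1 / (real h * real m)) \<le> ?L * ?L"
  proof -
    have "(\<Sum>(h,m)\<in>?P. 1 / (real h * real m)) = (\<Sum>h=1..<T. 1 / real h) * (\<Sum>m\<in>{nat \<lfloor>sqrt T\<rfloor><..T}. 1 / real m)"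
      by (simp add: sum_product sum.cartesian_product)
    also have "\<dots> \<le> ?L * ?L"
      using h1 L assms sum_inverse_le_ln by (intro mult_mono) (auto intro!: sum_nonneg)
    finally show ?thesis .
  qed
  have "X = (\<Sum>p\<in>?P. sqrt (1 / (real (fst p) * real (snd p))) *
      (cmod (exp_sum T (fst p * snd p)) * sqrt (1 / (real (fst p) * real (snd p)))))"
    unfolding X_def
  proof (intro sum.cong refl)
    fix p
    have split_k: "e / k = sqrt (1 / k) * (e * sqrt (1 / k))" if "k \<ge> 0" for e k :: real
    proof -
      have "sqrt (1 / k) * (e * sqrt (1 / k)) = e * (sqrt (1 / k) * sqrt (1 / k))" by (simp only: mult_ac)
      also have "\<dots> = e / k" using that by (simp only: real_sqrt_mult_self) simp
      finally show ?thesis by simp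
    qed
    show "(case p of (h, m) \<Rightarrow> cmod (exp_sum T (h * m)) / (real h * real m)) =
      sqrt (1 / (real (fst p) * real (snd p))) *
      (cmod (exp_sum T (fst p * snd p)) * sqrt (1 / (real (fst p) * real (snd p))))"
      unfolding case_prod_unfold by (rule split_k) simp
  qed
  hence "X\<^sup>2 \<le> (\<Sum>p\<in>?P. (sqrt (1 / (real (fst p) * real (snd p))))\<^sup>2) *
      (\<Sum>p\<in>?P. (cmod (exp_sum T (fst p * snd p)) * sqrt (1 / (real (fst p) * real (snd p))))\<^sup>2)"
    by (simp only: Cauchy_Schwarz_ineq_sum)
  also have "\<dots> = (\<Sum>(h,m)\<in>?P. 1 / (real h * real m)) *
      (\<Sum>(h,m)\<in>?P. (cmod (exp_sum T (h * m)))\<^sup>2 / (real h * real m))"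
    by (intro arg_cong2[of _ _ _ _ "(*)"] sum.cong refl) (auto simp: power_mult_distrib)
  also have "\<dots> \<le> (?L * ?L) * (10 * real T powr (7/2) * ?L ^ 3)"
    using W Z L by (intro mult_mono) (auto intro!: sum_nonneg)
  also have "\<dots> = 10 * real T powr (7/2) * ?L ^ 5" by (simp add: power_def numeral_eq_Suc)
  \<comment> \<open>Rounding 10 up to 16 and the exponent 5 up to 6 makes the bound a perfect
    square.\<close>
  also have "\<dots> \<le> 16 * real T powr (7/2) * ?L ^ 6"
    using L by (intro mult_mono power_increasing) auto
  also have "\<dots> = (4 * real T powr (7/4) * ?L ^ 3)\<^sup>2"
  proof -
    have "(real T powr (7/4))\<^sup>2 = real T powr (7/2)" by (simp add: power2_eq_square flip: powr_add)
    thus ?thesis by (simp only: power_mult_distrib power_mult[symmetric]) simp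
  qed
  finally have "X \<le> 4 * real T powr (7/4) * ?L ^ 3"
    by (rule power2_le_imp_le) (use L in simp)
  thus ?thesis by (simp only: X_def sum.cartesian_product)
qed

section \<open>The error term\<close>

text \<open>The weight \<open>1 / m\<close> serves two purposes: it comes from the trivial bound
  \<open>T / m\<close> for the Mertens value, and it matches the weights in
  \<open>sum_norm_exp_sum_le\<close>.\<close>

lemma sum_abs_sawtooth_sum_le:
  assumes "T \<ge> 16"
  shows "(\<Sum>m\<in>{nat \<lfloor>sqrt T\<rfloor><..T}. \<bar>\<Sum>\<xi>\<in>farey_half T. frac (real m * \<xi>\<^sup>2) - 1/2\<bar> / real m) \<le>
     7 * real T powr (7/4) * (1 + ln (real T)) ^ 3"
proof -
  let ?L = "1 + ln (real T)"
  let ?I = "{nat \<lfloor>sqrt T\<rfloor><..T}"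
  have L: "?L \<ge> 1" using assms by simp
  have T: "real T > 0" using assms by simp
  have sq: "sqrt T \<ge> 4" using assms by (intro real_le_rsqrt) simp
  have main: "\<bar>\<Sum>\<xi>\<in>farey_half T. frac (real m * \<xi>\<^sup>2) - 1/2\<bar> / real m \<le>
      3 * real T powr (3/2) * (1 / real m) + (\<Sum>h=1..<T. cmod (exp_sum T (h * m)) / (real h * real m))" for m
  proof -
    have "\<bar>\<Sum>\<xi>\<in>farey_half T. frac (real m * \<xi>\<^sup>2) - 1/2\<bar> \<le>
        real (card (farey_half T)) * (2 * (1 / sqrt T) + 1 / (4 * real T * (1 / sqrt T))) +
        (\<Sum>h=1..<T. 1 / real h * cmod (\<Sum>\<xi>\<in>farey_half T. cis (2 * pi * real h * (real m * \<xi>\<^sup>2))))"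
      \<comment> \<open>Taking \<open>H = T\<close> and \<open>D = 1 / sqrt T\<close> makes both
        approximation errors of order \<open>1 / sqrt T\<close>; the condition
        \<open>D \<le> 1/4\<close> is where \<open>T \<ge> 16\<close> enters.\<close>
      by (rule abs_sum_sawtooth_le) (use assms sq in \<open>auto simp: field_simps\<close>)
    also have "2 * (1 / sqrt T) + 1 / (4 * real T * (1 / sqrt T)) = 9/4 / sqrt T"
      using T by (simp add: field_simps)
    also have "real (card (farey_half T)) * (9/4 / sqrt T) \<le> (real T)\<^sup>2 * (9/4 / sqrt T)"
      using assms by (intro mult_right_mono card_farey_half_le) auto
    also have "\<dots> = 9/4 * real T powr (3/2)"
    proof -
      have "(real T)\<^sup>2 = real T powr 2" using T by simp
      moreover have "sqrt T = real T powr (1/2)" using T by (simp add: powr_half_sqrt)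
      ultimately have "(real T)\<^sup>2 / sqrt T = real T powr (2 - 1/2)" by (simp only: powr_diff)
      thus ?thesis by simp
    qed
    also have "\<dots> \<le> 3 * real T powr (3/2)" by simp
    also have "(\<Sum>h=1..<T. 1 / real h * cmod (\<Sum>\<xi>\<in>farey_half T. cis (2 * pi * real h * (real m * \<xi>\<^sup>2)))) =
        (\<Sum>h=1..<T. cmod (exp_sum T (h * m)) / real h)"
      by (simp add: mult.assoc)
    finally have "\<bar>\<Sum>\<xi>\<in>farey_half T. frac (real m * \<xi>\<^sup>2) - 1/2\<bar> / real m \<le>
        (3 * real T powr (3/2) + (\<Sum>h=1..<T. cmod (exp_sum T (h * m)) / real h)) / real m"
      by (intro divide_right_mono) auto
    also have "\<dots> = 3 * real T powr (3/2) * (1 / real m) + (\<Sum>h=1..<T. cmod (exp_sum T (h * m)) / (real h * real m))"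
      by (simp add: add_divide_distrib sum_divide_distrib)
    finally show ?thesis .
  qed
  have "(\<Sum>m\<in>?I. \<bar>\<Sum>\<xi>\<in>farey_half T. frac (real m * \<xi>\<^sup>2) - 1/2\<bar> / real m) \<le>
      (\<Sum>m\<in>?I. 3 * real T powr (3/2) * (1 / real m) + (\<Sum>h=1..<T. cmod (exp_sum T (h * m)) / (real h * real m)))"
    by (rule sum_mono) (rule main)
  also have "\<dots> = 3 * real T powr (3/2) * (\<Sum>m\<in>?I. 1 / real m) +
      (\<Sum>h=1..<T. \<Sum>m\<in>?I. cmod (exp_sum T (h * m)) / (real h * real m))"
    unfolding sum.distrib sum_distrib_left by (rule arg_cong[OF sum.swap])
  also have "\<dots> \<le> 3 * real T powr (7/4) * ?L ^ 3 + 4 * real T powr (7/4) * ?L ^ 3"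
  proof (intro add_mono mult_mono mult_left_mono)
    show "real T powr (3/2) \<le> real T powr (7/4)" using assms by (intro powr_mono) auto
    have "(\<Sum>m\<in>?I. 1 / real m) \<le> ?L" using assms by (intro sum_inverse_le_ln) simp
    also have "?L \<le> ?L ^ 3" using L by (simp add: self_le_power)
    finally show "(\<Sum>m\<in>?I. 1 / real m) \<le> ?L ^ 3" .
    show "(\<Sum>h=1..<T. \<Sum>m\<in>?I. cmod (exp_sum T (h * m)) / (real h * real m)) \<le>
        4 * real T powr (7/4) * ?L ^ 3"
      using assms by (intro sum_norm_exp_sum_le) simp
  qed (auto intro!: sum_nonneg)
  also have "\<dots> = 7 * real T powr (7/4) * ?L ^ 3" by simp
  finally show ?thesis .
qed

lemma abs_farey_C_minus_le:
  assumes "T \<ge> 16"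
  shows "\<bar>farey_C T - farey_count T * farey_G T\<bar> \<le>
     2 * (real T)\<^sup>2 * (\<Sum>m=1..nat \<lfloor>sqrt T\<rfloor>. \<bar>mertens (real T / real m)\<bar>) +
     8 * real T powr (11/4) * (1 + ln (real T)) ^ 3"
proof -
  let ?L = "1 + ln (real T)"
  let ?M = "\<lambda>m. mertens (real T / real m)"
  define p where "p = nat \<lfloor>sqrt T\<rfloor>"
  define c where "c = real (card (farey_half T))"
  define Q where "Q m = (\<Sum>\<xi>\<in>farey_half T. frac (real m * \<xi>\<^sup>2))" for m :: nat
  define R where "R m = (\<Sum>\<xi>\<in>farey_half T. frac (real m * \<xi>\<^sup>2) - 1/2)" for m :: nat
  define B where "B = (\<Sum>m=1..p. \<bar>?M m\<bar>)"
  have T: "T > 0" using assms by simp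
  have L: "?L \<ge> 1" using assms by simp
  have c: "0 \<le> c" "c \<le> (real T)\<^sup>2" using card_farey_half_le[OF T] by (auto simp: c_def)
  have B: "0 \<le> B" by (auto simp: B_def intro!: sum_nonneg)
  have QR: "Q m = c / 2 + R m" for m
    by (simp add: Q_def R_def c_def sum_subtractf)
  have Q: "\<bar>Q m\<bar> \<le> c" for m
  proof -
    have "0 \<le> Q m" unfolding Q_def by (intro sum_nonneg) simp
    moreover have "Q m \<le> (\<Sum>\<xi>\<in>farey_half T. 1)"
      unfolding Q_def by (intro sum_mono) (simp add: frac_lt_1 less_imp_le)
    ultimately show ?thesis by (simp add: c_def)
  qed
  have "sqrt T \<le> real T" using assms by (intro real_le_lsqrt) (auto simp: power2_eq_square)
  hence pT: "p \<le> T" unfolding p_def by linarith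
  have split: "{1..T} = {1..p} \<union> {p<..T}" "{1..p} \<inter> {p<..T} = {}" using pT by auto
  have split_sum: "(\<Sum>m=1..T. f m) = (\<Sum>m=1..p. f m) + (\<Sum>m\<in>{p<..T}. f m)" for f :: "nat \<Rightarrow> real"
    unfolding split(1) using split(2) by (intro sum.union_disjoint) auto
  have "(\<Sum>\<xi>\<in>{\<xi>\<in>farey T. \<xi> \<le> 1/2}. frac (real m * \<xi>\<^sup>2)) = Q m" for m
    unfolding Q_def using finite_farey[of T] farey_bounds
    by (intro sum.mono_neutral_right) (force simp: farey_half_def)+
  hence "farey_C T - farey_count T * farey_G T = - (\<Sum>m=1..T. ?M m * Q m)"
    by (simp only: farey_C_minus_eq)
  also have "(\<Sum>m=1..T. ?M m * Q m) = (\<Sum>m=1..p. ?M m * Q m) + (\<Sum>m\<in>{p<..T}. ?M m * Q m)"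
    by (rule split_sum)
  also have "(\<Sum>m\<in>{p<..T}. ?M m * Q m) = c / 2 * (\<Sum>m\<in>{p<..T}. ?M m) + (\<Sum>m\<in>{p<..T}. ?M m * R m)"
    by (simp add: QR algebra_simps sum.distrib sum_distrib_left)
  finally have eq: "farey_C T - farey_count T * farey_G T = - ((\<Sum>m=1..p. ?M m * Q m) +
      (c / 2 * (\<Sum>m\<in>{p<..T}. ?M m) + (\<Sum>m\<in>{p<..T}. ?M m * R m)))" .
  have 1: "\<bar>\<Sum>m=1..p. ?M m * Q m\<bar> \<le> c * B"
  proof -
    have "\<bar>\<Sum>m=1..p. ?M m * Q m\<bar> \<le> (\<Sum>m=1..p. \<bar>?M m * Q m\<bar>)" by (rule sum_abs)
    also have "\<dots> \<le> (\<Sum>m=1..p. c * \<bar>?M m\<bar>)"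
    proof (rule sum_mono)
      fix m
      show "\<bar>?M m * Q m\<bar> \<le> c * \<bar>?M m\<bar>"
        using mult_left_mono[OF Q[of m], of "\<bar>?M m\<bar>"] by (simp add: abs_mult mult.commute)
    qed
    finally show ?thesis by (simp add: B_def sum_distrib_left)
  qed
  have 2: "\<bar>c / 2 * (\<Sum>m\<in>{p<..T}. ?M m)\<bar> \<le> c / 2 * (1 + B)"
  proof -
    \<comment> \<open>As all Mertens values together sum to 1, the constant part over
      \<open>m > p\<close> is again controlled by \<open>B\<close>, a sum over
      \<open>m \<le> p\<close>.\<close>
    have "(\<Sum>m\<in>{p<..T}. ?M m) = 1 - (\<Sum>m=1..p. ?M m)"
      using split_sum[of ?M] sum_mertens_quotients[of T] T by simp
    moreover have "\<bar>\<Sum>m=1..p. ?M m\<bar> \<le> B" unfolding B_def by (rule sum_abs)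
    ultimately have "\<bar>\<Sum>m\<in>{p<..T}. ?M m\<bar> \<le> 1 + B" by linarith
    thus ?thesis unfolding abs_mult using c by (intro mult_mono) auto
  qed
  have 3: "\<bar>\<Sum>m\<in>{p<..T}. ?M m * R m\<bar> \<le> 7 * real T powr (11/4) * ?L ^ 3"
  proof -
    have "\<bar>\<Sum>m\<in>{p<..T}. ?M m * R m\<bar> \<le> (\<Sum>m\<in>{p<..T}. \<bar>?M m * R m\<bar>)" by (rule sum_abs)
    also have "\<dots> \<le> (\<Sum>m\<in>{p<..T}. real T * (\<bar>R m\<bar> / real m))"
    proof (intro sum_mono)
      fix m
      have "\<bar>?M m\<bar> \<le> real T / real m" by (rule abs_mertens_le) simp
      hence "\<bar>?M m\<bar> * \<bar>R m\<bar> \<le> real T / real m * \<bar>R m\<bar>" by (rule mult_right_mono) simp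
      thus "\<bar>?M m * R m\<bar> \<le> real T * (\<bar>R m\<bar> / real m)" by (simp add: abs_mult)
    qed
    also have "\<dots> = real T * (\<Sum>m\<in>{p<..T}. \<bar>R m\<bar> / real m)" by (rule sum_distrib_left[symmetric])
    also have "\<dots> \<le> real T * (7 * real T powr (7/4) * ?L ^ 3)"
      unfolding R_def p_def using assms by (intro mult_left_mono sum_abs_sawtooth_sum_le) auto
    also have "\<dots> = 7 * real T powr (11/4) * ?L ^ 3"
    proof -
      have "real T powr (1 + 7/4) = real T powr 1 * real T powr (7/4)" by (rule powr_add)
      thus ?thesis using T by simp
    qed
    finally show ?thesis .
  qed
  have 4: "(real T)\<^sup>2 \<le> real T powr (11/4) * ?L ^ 3"
  proof -
    have "(real T)\<^sup>2 * 1 \<le> real T powr (11/4) * ?L ^ 3"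
    proof (rule mult_mono)
      have "(real T)\<^sup>2 = real T powr 2" using T by simp
      also have "\<dots> \<le> real T powr (11/4)" using T by (intro powr_mono) auto
      finally show "(real T)\<^sup>2 \<le> real T powr (11/4)" .
      show "1 \<le> ?L ^ 3" using L by (rule one_le_power)
    qed auto
    thus ?thesis by simp
  qed
  have 5: "c * B \<le> (real T)\<^sup>2 * B" using c B by (intro mult_right_mono) auto
  have "c / 2 * (1 + B) = c / 2 + c * B / 2" by (simp add: algebra_simps)
  hence "\<bar>farey_C T - farey_count T * farey_G T\<bar> \<le>
      c * B + (c / 2 + c * B / 2) + 7 * real T powr (11/4) * ?L ^ 3"
    using 1 2 3 unfolding eq by linarith
  also have "\<dots> \<le> 2 * ((real T)\<^sup>2 * B) + 8 * (real T powr (11/4) * ?L ^ 3)"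
  proof -
    \<comment> \<open>Here \<open>u\<close>, \<open>v\<close>, \<open>a\<close>, \<open>t\<close>
      and \<open>x\<close> stand for \<open>c * B\<close>, \<open>T\<^sup>2 * B\<close>,
      \<open>c\<close>, \<open>T\<^sup>2\<close> and \<open>T powr (11/4) * ?L ^ 3\<close>; the
      abstraction leaves a linear inequality.\<close>
    have "u + (a / 2 + u / 2) + 7 * x \<le> 2 * v + 8 * x"
      if "0 \<le> u" "u \<le> v" "0 \<le> a" "a \<le> t" "t \<le> x" for u v a t x :: real
      using that by linarith
    from this[OF mult_nonneg_nonneg[OF c(1) B] 5 c 4] show ?thesis by (simp only: mult.assoc)
  qed
  finally show ?thesis by (simp add: B_def p_def)
qed

section \<open>The \<open>\<delta>\<close>-term and the conclusion\<close>

text \<open>For \<open>m \<le> sqrt T\<close> the argument \<open>T / m\<close> is at least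
  \<open>sqrt T\<close>, where \<open>\<delta>\<close> is at most \<open>\<delta> (sqrt T)\<close>;
  summing \<open>1 / m\<close> gives the logarithm.\<close>

lemma sum_abs_mertens_quotients_le:
  assumes "T \<ge> 1"
    and mono: "\<And>s t. 1 \<le> s \<Longrightarrow> s \<le> t \<Longrightarrow> \<delta> t \<le> \<delta> s"
    and \<delta>: "\<And>t. 1 \<le> t \<Longrightarrow> \<bar>mertens t\<bar> \<le> t * \<delta> t"
  shows "(\<Sum>m=1..nat \<lfloor>sqrt T\<rfloor>. \<bar>mertens (real T / real m)\<bar>) \<le> real T * \<delta> (sqrt T) * (1 + ln (real T))"
proof -
  have sq: "sqrt T \<ge> 1" using assms by simp
  \<comment> \<open>Nonnegativity of \<open>\<delta>\<close> is no assumption; at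
    \<open>sqrt T\<close> it follows from the Mertens bound itself.\<close>
  have "0 \<le> \<bar>mertens (sqrt T)\<bar>" by simp
  also have "\<dots> \<le> sqrt T * \<delta> (sqrt T)" using sq by (rule \<delta>)
  finally have "0 \<le> sqrt T * \<delta> (sqrt T)" .
  hence d0: "0 \<le> \<delta> (sqrt T)" using sq by (simp add: zero_le_mult_iff)
  have "(\<Sum>m=1..nat \<lfloor>sqrt T\<rfloor>. \<bar>mertens (real T / real m)\<bar>) \<le>
      (\<Sum>m=1..nat \<lfloor>sqrt T\<rfloor>. real T * \<delta> (sqrt T) * (1 / real m))"
  proof (intro sum_mono)
    fix m assume "m \<in> {1..nat \<lfloor>sqrt T\<rfloor>}"
    hence m: "m \<ge> 1" "real m \<le> sqrt T" by (auto simp: le_nat_iff le_floor_iff)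
    have "sqrt T * real m \<le> sqrt T * sqrt T" using m sq by (intro mult_left_mono) auto
    hence tm: "sqrt T \<le> real T / real m" using m by (simp add: field_simps)
    have "\<bar>mertens (real T / real m)\<bar> \<le> real T / real m * \<delta> (real T / real m)"
      using tm sq by (intro \<delta>) linarith
    also have "\<dots> \<le> real T / real m * \<delta> (sqrt T)"
      using tm sq by (intro mult_left_mono mono) auto
    finally show "\<bar>mertens (real T / real m)\<bar> \<le> real T * \<delta> (sqrt T) * (1 / real m)" by simp
  qed
  also have "\<dots> = real T * \<delta> (sqrt T) * (\<Sum>m=1..nat \<lfloor>sqrt T\<rfloor>. 1 / real m)"
    by (rule sum_distrib_left[symmetric])
  also have "\<dots> \<le> real T * \<delta> (sqrt T) * (1 + ln (real T))"
  proof (rule mult_left_mono)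
    have "sqrt T \<le> real T" using assms by (intro real_le_lsqrt) (auto simp: power2_eq_square)
    hence "nat \<lfloor>sqrt T\<rfloor> \<le> T" by linarith
    hence "(\<Sum>m=1..nat \<lfloor>sqrt T\<rfloor>. 1 / real m) \<le> (\<Sum>m\<in>{0<..T}. 1 / real m)"
      by (intro sum_mono2) auto
    also have "\<dots> \<le> 1 + ln (real T)" using assms by (intro sum_inverse_le_ln) simp
    finally show "(\<Sum>m=1..nat \<lfloor>sqrt T\<rfloor>. 1 / real m) \<le> 1 + ln (real T)" .
  qed (use d0 in simp)
  finally show ?thesis .
qed

text \<open>The constant, the sequence \<open>\<epsilon>\<close> standing for \<open>o(1)\<close>
  and the threshold are chosen before \<open>\<delta>\<close>, which makes the bound uniform in
  \<open>\<delta>\<close>. Decreasing is meant in the weak sense on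
  \<open>[1, \<infinity>)\<close>.\<close>

theorem theorem1p1:
  "\<exists>(c::real) (\<epsilon>::nat \<Rightarrow> real) (T0::nat). c > 0 \<and> \<epsilon> \<longlonglongrightarrow> 0 \<and>
     (\<forall>\<delta>::real \<Rightarrow> real.
        (\<forall>s t. 1 \<le> s \<longrightarrow> s \<le> t \<longrightarrow> \<delta> t \<le> \<delta> s) \<longrightarrow>
        (\<forall>t. 1 \<le> t \<longrightarrow> \<bar>mertens t\<bar> \<le> t * \<delta> t) \<longrightarrow>
        (\<forall>T. T \<ge> T0 \<longrightarrow>
           \<bar>farey_C T - farey_count T * farey_G T\<bar>
             \<le> c * (real T powr (11/4 + \<epsilon> T) + real T ^ 3 * \<delta> (sqrt (real T)) * ln (real T))))"
proof (intro exI conjI allI impI)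
  show "(64::real) > 0" by simp
  \<comment> \<open>This \<open>\<epsilon>\<close> is chosen so that
    \<open>T powr \<epsilon> T\<close> is exactly the cube of \<open>ln T\<close>.\<close>
  show "(\<lambda>T::nat. 3 * ln (ln (real T)) / ln (real T)) \<longlonglongrightarrow> 0" by real_asymp
  fix \<delta> :: "real \<Rightarrow> real" and T :: nat
  assume mono: "\<forall>s t. 1 \<le> s \<longrightarrow> s \<le> t \<longrightarrow> \<delta> t \<le> \<delta> s"
    and \<delta>: "\<forall>t. 1 \<le> t \<longrightarrow> \<bar>mertens t\<bar> \<le> t * \<delta> t" and T: "T \<ge> 16"
  let ?l = "ln (real T)"
  let ?S = "\<Sum>m=1..nat \<lfloor>sqrt T\<rfloor>. \<bar>mertens (real T / real m)\<bar>"
  have "exp 1 \<le> real T" using exp_le T by simp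
  hence l: "?l \<ge> 1" using T by (subst ln_ge_iff) auto
  have S: "?S \<le> real T * \<delta> (sqrt T) * (1 + ?l)"
    by (rule sum_abs_mertens_quotients_le) (use T mono \<delta> in auto)
  have "0 \<le> ?S" by (intro sum_nonneg) auto
  hence "0 \<le> real T * \<delta> (sqrt T) * (1 + ?l)" using S by linarith
  hence d0: "0 \<le> real T * \<delta> (sqrt T)" using l by (simp add: zero_le_mult_iff)
  have "real T * \<delta> (sqrt T) * (1 + ?l) \<le> real T * \<delta> (sqrt T) * (2 * ?l)"
    using l d0 by (intro mult_left_mono) auto
  hence "2 * (real T)\<^sup>2 * ?S \<le> 2 * (real T)\<^sup>2 * (real T * \<delta> (sqrt T) * (2 * ?l))"
    using S by (intro mult_left_mono) auto
  also have "\<dots> = 4 * (real T ^ 3 * \<delta> (sqrt T) * ?l)" by (simp add: power2_eq_square power3_eq_cube)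
  finally have 1: "2 * (real T)\<^sup>2 * ?S \<le> 4 * (real T ^ 3 * \<delta> (sqrt T) * ?l)" .
  \<comment> \<open>From \<open>ln T \<ge> 1\<close> comes \<open>1 + ln T \<le> 2 * ln T\<close>,
    and its cube turns 8 into the final constant 64.\<close>
  have "8 * real T powr (11/4) * (1 + ?l) ^ 3 \<le> 8 * real T powr (11/4) * (2 * ?l) ^ 3"
    using l by (intro mult_left_mono power_mono) auto
  also have "\<dots> = 64 * (real T powr (11/4) * ?l ^ 3)" by (simp add: power_mult_distrib)
  also have "?l ^ 3 = real T powr (3 * ln ?l / ?l)"
  proof -
    have "real T powr (3 * ln ?l / ?l) = exp (3 * ln ?l)" using l T by (simp add: powr_def)
    also have "\<dots> = ?l powr 3" using l by (simp add: powr_def)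
    also have "\<dots> = ?l ^ 3" using l by simp
    finally show ?thesis by simp
  qed
  also have "real T powr (11/4) * real T powr (3 * ln ?l / ?l) = real T powr (11/4 + 3 * ln ?l / ?l)"
    by (rule powr_add[symmetric])
  finally have 2: "8 * real T powr (11/4) * (1 + ?l) ^ 3 \<le> 64 * real T powr (11/4 + 3 * ln ?l / ?l)" .
  have "0 \<le> (real T)\<^sup>2 * (real T * \<delta> (sqrt T)) * ?l"
    by (rule mult_nonneg_nonneg[OF mult_nonneg_nonneg[OF zero_le_power2 d0]]) (use l in linarith)
  hence 3: "0 \<le> real T ^ 3 * \<delta> (sqrt T) * ?l" by (simp add: power2_eq_square power3_eq_cube)
  \<comment> \<open>Raising the coefficient 4 of the \<open>\<delta>\<close>-term to 64 relies on
    that term being nonnegative.\<close>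
  have absorb: "4 * D + 64 * P \<le> 64 * (P + D)" if "0 \<le> D" for D P :: real using that by simp
  show "\<bar>farey_C T - farey_count T * farey_G T\<bar> \<le>
      64 * (real T powr (11/4 + 3 * ln ?l / ?l) + real T ^ 3 * \<delta> (sqrt T) * ?l)"
    by (rule order_trans[OF abs_farey_C_minus_le[OF T] order_trans[OF add_mono[OF 1 2] absorb[OF 3]]])
qed

end
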